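(* Fix $N=4m$ with $m\ge1$. For every $Z\in S=\bigcup_{\gamma\in\Gamma(N)}\mathfrak h_n^\gamma$ there is a unique $\gamma=\begin{pmatrix}A&B\\C&D\end{pmatrix}\in\Gamma(N)$ with $\gamma Z=-\overline Z$; let $\kappa_Z(M)={}^t(CZ+D)\overline M$ and $\mathcal A_Z=(A_Z,H_Z,\kappa_Z,\{F_Z(e_i/N),F_Z(f_j/N)\})$. Then $\mathcal A_Z$ is a real principally polarized abelian variety with level $N$ structure, and the association $Z\mapsto\mathcal A_Z$ induces a bijection between the points of $X_{\mathbb R}$ (the fixed points of the involution induced by $Z\mapsto-\overline Z$ on $X=\Gamma(N)\backslash\mathfrak h_n$) and the set of isomorphism classes of real principally polarized abelian varieties with level $N$ structure.
   Context: $\mathbf{Sp}(2n,\mathbb R)$: real $2n\times 2n$ matrices $g=\begin{pmatrix}A&B\\C&D\end{pmatrix}$ with ${}^tgJg=J$, $J=\begin{pmatrix}0&I\\-I&0\end{pmatrix}$; $\mathfrak h_n=\{Z\in M_n(\mathbb C):{}^tZ=Z,\mathrm{Im}Z>0\}$ with action $gZ=(AZ+B)(CZ+D)^{-1}$; $\mathfrak h_n^\gamma=\{Z:\gamma Z=-\overline Z\}$; $\Gamma(N)=\{\gamma\in\mathbf{Sp}(2n,\mathbb Z):\gamma\equiv I\bmod N\}$. Abelian varieties: a principally polarized abelian variety is a pair $(A=\mathbb C^n/L,H)$ with $H$ a positive definite Hermitian form on $\mathbb C^n$, $Q=\mathrm{Im}H$, and $L$ a lattice having a basis (called symplectic) in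 which the matrix of $Q$ is $\begin{pmatrix}0&I\\-I&0\end{pmatrix}$. A real structure is a complex antilinear involution $\kappa$ of $\mathbb C^n$ with $\kappa(L)=L$ and $Q(\kappa u,\kappa v)=-Q(u,v)$. A level $N$ structure is a basis $\{U_i,V_j\}_{1\le i,j\le n}$ of the $N$-torsion points of $A$ such that for some symplectic basis $\{u_i,v_j\}$ of $L$ (a "lift") $U_i\equiv u_i/N$, $V_j\equiv v_j/N \bmod L$; it is compatible with $\kappa$ if, for a lift, $\kappa(u_i/N)\equiv -u_i/N$ and $\kappa(v_j/N)\equiv v_j/N\bmod L$ for all $i,j$. A real principally polarized abelian variety with level $N$ structure is a quadruple $(A,H,\kappa,\{U_i,V_j\})$ with compatible level structure. An isomorphism $(A,H,\kappa,\{U_i,V_j\})\to(A',H',\kappa',\{U_i',V_j'\})$ is a complex linear $\phi:\mathbb C^n\to\mathbb C^n$ with $\phi(L)=L'$, $H'(\phi u,\phi v)=H(u,v)$, $\phi\kappa\phi^{-1}=\kappa'$, and $\phi(u_i/N)\equiv u_i'/N$, $\phi(v_j/N)\equiv v_j'/N\bmod L'$ for lifts. For $Z\in\mathfrak h_n$: $F_Z:\mathbb R^n\oplus\mathbb R^n\to\mathbb C^n$, $F_Z(x,y)=Zx+y$; $L_Z=F_Z(\mathbb Z^n\oplus\mathbb Z^n)$; $H_Z(u,v)={}^tu(\mathrm{Im}Z)^{-1}\overline v$; $A_Z=\mathbb C^n/L_Z$; $\{e_i,f_j\}$ is the standard basis of $\mathbb R^n\oplus\mathbb R^n$, and $\{F_Z(e_i/N),F_Z(f_j/N)\}\bmod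 L_Z$ is the standard level $N$ structure. *)

theory Defs
  imports "HOL-Analysis.Analysis"
begin

type_synonym 'n cmat = "complex^'n^'n"
type_synonym 'n cvec = "complex^'n"
type_synonym 'n imat = "int^'n^'n"

text \<open>An integer symplectic matrix g = (A B; C D) is represented by its four n x n blocks.\<close>
type_synonym 'n blk = "'n imat \<times> 'n imat \<times> 'n imat \<times> 'n imat"

definition cmat_of_int :: "'n imat \<Rightarrow> ('n::finite) cmat" where
  "cmat_of_int M = (\<chi> i j. of_int (M $ i $ j))"

definition ImM :: "('n::finite) cmat \<Rightarrow> real^'n^'n" where
  "ImM Z = (\<chi> i j. Im (Z $ i $ j))"

definition cnjM :: "('n::finite) cmat \<Rightarrow> 'n cmat" where
  "cnjM Z = (\<chi> i j. cnj (Z $ i $ j))"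

definition cnjV :: "('n::finite) cvec \<Rightarrow> 'n cvec" where
  "cnjV v = (\<chi> i. cnj (v $ i))"

definition siegel :: "('n::finite) cmat set" where
  "siegel = {Z. transpose Z = Z \<and> (\<forall>x::real^'n. x \<noteq> 0 \<longrightarrow> x \<bullet> (ImM Z *v x) > 0)}"

text \<open>Sp(2n,Z): tgJg = J written out blockwise.\<close>
definition Sp_int :: "('n::finite) blk set" where
  "Sp_int = {(A,B,C,D).
      transpose A ** C - transpose C ** A = 0 \<and>
      transpose A ** D - transpose C ** B = mat 1 \<and>
      transpose B ** C - transpose D ** A = - mat 1 \<and>
      transpose B ** D - transpose D ** B = 0}"

definition Gamma :: "nat \<Rightarrow> ('n::finite) blk set" where
  "Gamma N = {(A,B,C,D). (A,B,C,D) \<in> Sp_int \<and>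
      (\<forall>i j. int N dvd (A $ i $ j - (mat 1 :: 'n imat) $ i $ j) \<and>
             int N dvd B $ i $ j \<and>
             int N dvd C $ i $ j \<and>
             int N dvd (D $ i $ j - (mat 1 :: 'n imat) $ i $ j))}"

definition act :: "('n::finite) blk \<Rightarrow> 'n cmat \<Rightarrow> 'n cmat" where
  "act g Z = (case g of (A,B,C,D) \<Rightarrow>
     (cmat_of_int A ** Z + cmat_of_int B) ** matrix_inv (cmat_of_int C ** Z + cmat_of_int D))"

definition Sset :: "nat \<Rightarrow> ('n::finite) cmat set" where
  "Sset N = {Z \<in> siegel. \<exists>\<gamma>\<in>Gamma N. act \<gamma> Z = - cnjM Z}"

definition orbit :: "nat \<Rightarrow> ('n::finite) cmat \<Rightarrow> 'n cmat set" where
  "orbit N Z = {act \<gamma> Z | \<gamma>. \<gamma> \<in> Gamma N}"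

definition X_R :: "nat \<Rightarrow> ('n::finite) cmat set set" where
  "X_R N = {orbit N Z | Z. Z \<in> siegel \<and> orbit N (- cnjM Z) = orbit N Z}"

text \<open>A quadruple (A = C^n/L, H, kappa, {U_i, V_j}); torsion points are given by
  representatives U i, V j in C^n (the point is the class modulo L).\<close>
record ('n::finite) rppav =
  lat :: "('n cvec) set"
  herm :: "'n cvec \<Rightarrow> 'n cvec \<Rightarrow> complex"
  kap :: "'n cvec \<Rightarrow> 'n cvec"
  lvU :: "'n \<Rightarrow> 'n cvec"
  lvV :: "'n \<Rightarrow> 'n cvec"

definition pos_def_hermitian :: "(('n::finite) cvec \<Rightarrow> 'n cvec \<Rightarrow> complex) \<Rightarrow> bool" where
  "pos_def_hermitian H \<longleftrightarrow>
     (\<forall>u v w. H (u + v) w = H u w + H v w) \<and>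
     (\<forall>c u v. H (c *s u) v = c * H u v) \<and>
     (\<forall>u v. H v u = cnj (H u v)) \<and>
     (\<forall>u. u \<noteq> 0 \<longrightarrow> Re (H u u) > 0 \<and> Im (H u u) = 0)"

definition symplectic_basis ::
  "(('n::finite) cvec \<Rightarrow> 'n cvec \<Rightarrow> complex) \<Rightarrow> 'n cvec set \<Rightarrow> ('n \<Rightarrow> 'n cvec) \<Rightarrow> ('n \<Rightarrow> 'n cvec) \<Rightarrow> bool" where
  "symplectic_basis H L u v \<longleftrightarrow>
     (\<forall>a b :: 'n \<Rightarrow> real. (\<Sum>i\<in>UNIV. a i *\<^sub>R u i + b i *\<^sub>R v i) = 0 \<longrightarrow> (\<forall>i. a i = 0 \<and> b i = 0)) \<and>
     L = {(\<Sum>i\<in>UNIV. of_int (a i) *\<^sub>R u i + of_int (b i) *\<^sub>R v i) | a b :: 'n \<Rightarrow> int. True} \<and>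
     (\<forall>i j. Im (H (u i) (u j)) = 0 \<and> Im (H (v i) (v j)) = 0 \<and>
            Im (H (u i) (v j)) = (if i = j then 1 else 0) \<and>
            Im (H (v i) (u j)) = (if i = j then -1 else 0))"

definition ppav :: "(('n::finite) cvec \<Rightarrow> 'n cvec \<Rightarrow> complex) \<Rightarrow> 'n cvec set \<Rightarrow> bool" where
  "ppav H L \<longleftrightarrow> pos_def_hermitian H \<and> (\<exists>u v. symplectic_basis H L u v)"

definition real_structure ::
  "(('n::finite) cvec \<Rightarrow> 'n cvec \<Rightarrow> complex) \<Rightarrow> 'n cvec set \<Rightarrow> ('n cvec \<Rightarrow> 'n cvec) \<Rightarrow> bool" where
  "real_structure H L \<kappa> \<longleftrightarrow>
     (\<forall>u v. \<kappa> (u + v) = \<kappa> u + \<kappa> v) \<and>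
     (\<forall>c u. \<kappa> (c *s u) = cnj c *s \<kappa> u) \<and>
     (\<forall>u. \<kappa> (\<kappa> u) = u) \<and>
     \<kappa> ` L = L \<and>
     (\<forall>u v. Im (H (\<kappa> u) (\<kappa> v)) = - Im (H u v))"

definition is_lift :: "nat \<Rightarrow> ('n::finite) rppav \<Rightarrow> ('n \<Rightarrow> 'n cvec) \<Rightarrow> ('n \<Rightarrow> 'n cvec) \<Rightarrow> bool" where
  "is_lift N X u v \<longleftrightarrow> symplectic_basis (herm X) (lat X) u v \<and>
     (\<forall>i. lvU X i - (1 / of_nat N) *s u i \<in> lat X \<and> lvV X i - (1 / of_nat N) *s v i \<in> lat X)"

definition real_ppav_level :: "nat \<Rightarrow> ('n::finite) rppav \<Rightarrow> bool" where
  "real_ppav_level N X \<longleftrightarrow>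
     ppav (herm X) (lat X) \<and> real_structure (herm X) (lat X) (kap X) \<and>
     (\<exists>u v. is_lift N X u v \<and>
        (\<forall>i. kap X ((1 / of_nat N) *s u i) + (1 / of_nat N) *s u i \<in> lat X \<and>
             kap X ((1 / of_nat N) *s v i) - (1 / of_nat N) *s v i \<in> lat X))"

text \<open>Isomorphism of real ppav's with level structure (phi kappa phi^-1 = kappa' written as
  phi o kappa = kappa' o phi for the bijective phi; the level condition uses representatives).\<close>
definition rppav_iso :: "nat \<Rightarrow> ('n::finite) rppav \<Rightarrow> 'n rppav \<Rightarrow> bool" where
  "rppav_iso N X Y \<longleftrightarrow> (\<exists>\<phi> :: 'n cvec \<Rightarrow> 'n cvec.
     (\<forall>u v. \<phi> (u + v) = \<phi> u + \<phi> v) \<and> (\<forall>c u. \<phi> (c *s u) = c *s \<phi> u) \<and> bij \<phi> \<and>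
     \<phi> ` lat X = lat Y \<and>
     (\<forall>u v. herm Y (\<phi> u) (\<phi> v) = herm X u v) \<and>
     \<phi> \<circ> kap X = kap Y \<circ> \<phi> \<and>
     (\<forall>i. \<phi> (lvU X i) - lvU Y i \<in> lat Y \<and> \<phi> (lvV X i) - lvV Y i \<in> lat Y))"

definition iso_classes :: "nat \<Rightarrow> ('n::finite) rppav set set" where
  "iso_classes N = {X. real_ppav_level N X} //
                   {(X, Y). real_ppav_level N X \<and> real_ppav_level N Y \<and> rppav_iso N X Y}"

definition iso_class :: "nat \<Rightarrow> ('n::finite) rppav \<Rightarrow> 'n rppav set" where
  "iso_class N X = {Y. real_ppav_level N Y \<and> rppav_iso N X Y}"

definition F_Z :: "('n::finite) cmat \<Rightarrow> real^'n \<Rightarrow> real^'n \<Rightarrow> 'n cvec" where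
  "F_Z Z x y = Z *v (\<chi> i. complex_of_real (x $ i)) + (\<chi> i. complex_of_real (y $ i))"

definition L_Z :: "('n::finite) cmat \<Rightarrow> 'n cvec set" where
  "L_Z Z = {F_Z Z x y | x y. \<forall>i. x $ i \<in> \<int> \<and> y $ i \<in> \<int>}"

definition H_Z :: "('n::finite) cmat \<Rightarrow> 'n cvec \<Rightarrow> 'n cvec \<Rightarrow> complex" where
  "H_Z Z u v = (\<Sum>i\<in>UNIV. \<Sum>j\<in>UNIV.
      u $ i * complex_of_real (matrix_inv (ImM Z) $ i $ j) * cnj (v $ j))"

definition gamma_of :: "nat \<Rightarrow> ('n::finite) cmat \<Rightarrow> 'n blk" where
  "gamma_of N Z = (THE \<gamma>. \<gamma> \<in> Gamma N \<and> act \<gamma> Z = - cnjM Z)"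

definition kappa_Z :: "nat \<Rightarrow> ('n::finite) cmat \<Rightarrow> 'n cvec \<Rightarrow> 'n cvec" where
  "kappa_Z N Z M = (case gamma_of N Z of (A,B,C,D) \<Rightarrow>
      transpose (cmat_of_int C ** Z + cmat_of_int D) *v cnjV M)"

definition A_Z :: "nat \<Rightarrow> ('n::finite) cmat \<Rightarrow> 'n rppav" where
  "A_Z N Z = \<lparr> lat = L_Z Z, herm = H_Z Z, kap = kappa_Z N Z,
      lvU = (\<lambda>i. F_Z Z (axis i (1 / real N)) 0),
      lvV = (\<lambda>j. F_Z Z 0 (axis j (1 / real N))) \<rparr>"

end

theory Submission
  imports Defs
begin

text \<open>A symplectic basis
  \<open>(u, v)\<close> of a polarized lattice has a unique period matrix \<open>Z\<close> with \<open>u = Z v\<close>, and changing the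
  basis by an integral symplectic matrix \<open>\<gamma>\<close> changes the period to \<open>\<gamma> Z\<close>. Hence
  \<open>\<gamma> \<in> \<Gamma>(N)\<close> with \<open>\<gamma> Z = Z'\<close> corresponds to an isomorphism \<open>A\<^sub>Z \<rightarrow> A\<^sub>Z\<^sub>'\<close> of polarized
  abelian varieties with level structure. Rigidity says that an automorphism \<open>f\<close> of such an object
  is trivial when \<open>N \<ge> 4\<close>: \<open>h = (f - 1)/N\<close> maps the lattice into itself and at least halves lengths, so it is
  nilpotent, and since \<open>f\<close> is unitary \<open>h\<close> vanishes.
  Write \<open>\<tau> Z\<close> for minus the conjugate of \<open>Z\<close>. Complex conjugation is an antilinear isomorphism from
  \<open>A\<^sub>Z\<close> to the variety with period \<open>\<tau> Z\<close>, so the compatible antilinear automorphisms of \<open>A\<^sub>Z\<close> are the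
  level isomorphisms from \<open>Z\<close> to \<open>\<tau> Z\<close> followed by conjugation; by rigidity they are involutions,
  unique, and hence commute with all level isomorphisms.\<close>

section \<open>Hermitian forms, symplectic bases and rigidity\<close>

definition clinear :: "(('n::finite) cvec \<Rightarrow> 'n cvec) \<Rightarrow> bool" where
  "clinear f \<longleftrightarrow> (\<forall>u v. f (u + v) = f u + f v) \<and> (\<forall>c u. f (c *s u) = c *s f u)"

definition rcomb :: "('n \<Rightarrow> real) \<Rightarrow> ('n \<Rightarrow> real) \<Rightarrow> ('n \<Rightarrow> 'n cvec) \<Rightarrow> ('n \<Rightarrow> 'n cvec) \<Rightarrow> ('n::finite) cvec"
  where "rcomb a b u v = (\<Sum>i\<in>UNIV. a i *\<^sub>R u i + b i *\<^sub>R v i)"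

lemma scaleR_eq_smult: "r *\<^sub>R (x :: ('n::finite) cvec) = of_real r *s x"
  unfolding vec_eq_iff vector_scaleR_component vector_smult_component by (simp add: scaleR_conv_of_real)

lemma clinear_add: "clinear f \<Longrightarrow> f (x + y) = f x + f y"
  and clinear_smult: "clinear f \<Longrightarrow> f (c *s x) = c *s f x"
  by (auto simp: clinear_def)

lemma clinear_0: "clinear f \<Longrightarrow> f 0 = 0"
  using clinear_smult[of f 0 0] by simp

lemma clinear_minus: "clinear f \<Longrightarrow> f (- x) = - f x"
  using clinear_smult[of f "-1" x] by (simp add: vector_smult_lneg)

lemma clinear_diff: "clinear f \<Longrightarrow> f (x - y) = f x - f y"
  using clinear_add[of f x "-y"] clinear_minus[of f y] by simp

lemma clinear_scaleR: "clinear f \<Longrightarrow> f (r *\<^sub>R x) = r *\<^sub>R f x"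
  by (simp add: scaleR_eq_smult clinear_smult)

lemma clinear_sum: "clinear f \<Longrightarrow> f (\<Sum>i\<in>S. g i) = (\<Sum>i\<in>S. f (g i))"
  by (induction S rule: infinite_finite_induct) (auto simp: clinear_0 clinear_add)

lemma clinear_rcomb: "clinear f \<Longrightarrow> f (rcomb a b u v) = rcomb a b (\<lambda>i. f (u i)) (\<lambda>i. f (v i))"
  by (simp add: rcomb_def clinear_sum clinear_add clinear_scaleR)

lemma clinear_comp: "clinear f \<Longrightarrow> clinear g \<Longrightarrow> clinear (f \<circ> g)"
  by (simp add: clinear_def)

lemma clinear_inv: assumes "clinear f" "bij f" shows "clinear (inv f)"
proof -
  have f: "f (inv f x) = x" for x using assms(2) by (simp add: bij_is_surj surj_f_inv_f)
  have i: "inv f (f x) = x" for x using assms(2) by (simp add: bij_is_inj)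
  show ?thesis unfolding clinear_def
  proof (intro conjI allI)
    show "inv f (x + y) = inv f x + inv f y" for x y
      using i[of "inv f x + inv f y"] by (simp add: clinear_add[OF assms(1)] f)
    show "inv f (c *s x) = c *s inv f x" for c x
      using i[of "c *s inv f x"] by (simp add: clinear_smult[OF assms(1)] f)
  qed
qed

lemma clinear_matrix_vector_mult: "clinear (\<lambda>x. W *v x)"
  by (simp add: clinear_def matrix_vector_right_distrib vector_scalar_commute)

lemma clinear_matrix: "clinear f \<Longrightarrow> matrix f *v x = f x"
  by (rule matrix_works) (simp add: clinear_def Vector_Spaces.linear_iff vec.vector_space_axioms)

lemma rcomb_add: "rcomb a b u v + rcomb a' b' u v = rcomb (\<lambda>i. a i + a' i) (\<lambda>i. b i + b' i) u v"
  by (simp add: rcomb_def sum.distrib scaleR_left_distrib)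
lemma rcomb_diff: "rcomb a b u v - rcomb a' b' u v = rcomb (\<lambda>i. a i - a' i) (\<lambda>i. b i - b' i) u v"
  by (simp add: rcomb_def sum.distrib scaleR_left_diff_distrib sum_subtractf)
lemma rcomb_scaleR: "r *\<^sub>R rcomb a b u v = rcomb (\<lambda>i. r * a i) (\<lambda>i. r * b i) u v"
  by (simp add: rcomb_def sum.distrib scaleR_sum_right scaleR_right_distrib)
lemma rcomb_left: "rcomb (\<lambda>i. if i = k then 1 else 0) (\<lambda>_. 0) u v = u k"
  and rcomb_right: "rcomb (\<lambda>_. 0) (\<lambda>i. if i = k then 1 else 0) u v = v k"
  by (simp_all add: rcomb_def if_distrib[of "\<lambda>x. x *\<^sub>R _"] cong: if_cong)
text \<open>The coordinate map from \<open>R^n x R^n\<close> to \<open>C^n\<close> is real linear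
  and injective, and both sides have real dimension \<open>2n\<close>.\<close>

lemma rcomb_surj:
  fixes u v :: "'n::finite \<Rightarrow> 'n cvec"
  assumes ind: "\<And>a b. rcomb a b u v = 0 \<Longrightarrow> (\<forall>i. a i = 0 \<and> b i = 0)"
  shows "\<exists>a b. w = rcomb a b u v"
proof -
  define T :: "(real^'n) \<times> (real^'n) \<Rightarrow> 'n cvec" where
    "T = (\<lambda>p. rcomb (\<lambda>i. fst p $ i) (\<lambda>i. snd p $ i) u v)"
  have lin: "linear T"
    by (rule linearI) (simp_all add: T_def rcomb_add rcomb_scaleR, simp_all add: rcomb_def)
  have inj: "inj T"
  proof (rule linear_injective_0[OF lin, THEN iffD2], intro allI impI)
    fix p assume "T p = 0"
    then have "\<forall>i. fst p $ i = 0 \<and> snd p $ i = 0" using ind unfolding T_def by blast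
    then show "p = 0" by (simp add: prod_eq_iff vec_eq_iff)
  qed
  have "dim (range T) = DIM((real^'n) \<times> (real^'n))"
    using dim_image_eq[OF lin, of UNIV] inj by simp
  also have "\<dots> = DIM('n cvec)" by simp
  finally have "span (range T) = UNIV" by (simp only: dim_eq_full[symmetric])
  moreover have "span (range T) = range T"
    by (simp add: lin linear_span_image span_UNIV)
  ultimately have "w \<in> range T" by auto
  then show ?thesis unfolding T_def by auto
qed

section \<open>Positive definite Hermitian forms and symplectic families\<close>

locale pd_herm = fixes H :: "('n::finite) cvec \<Rightarrow> 'n cvec \<Rightarrow> complex"
  assumes pdh: "pos_def_hermitian H"
begin

lemma add_left: "H (x + y) z = H x z + H y z"
  and smult_left: "H (c *s x) y = c * H x y"
  and cnj_H: "H y x = cnj (H x y)"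
  and pos: "x \<noteq> 0 \<Longrightarrow> Re (H x x) > 0"
  using pdh unfolding pos_def_hermitian_def by blast+

lemma add_right: "H z (x + y) = H z x + H z y"
  by (metis add_left cnj_H complex_cnj_add)
lemma smult_right: "H x (c *s y) = cnj c * H x y"
  by (metis smult_left cnj_H complex_cnj_mult)
lemma scaleR_left: "H (r *\<^sub>R x) y = of_real r * H x y"
  by (simp add: scaleR_eq_smult smult_left)
lemma scaleR_right: "H x (r *\<^sub>R y) = of_real r * H x y"
  by (simp add: scaleR_eq_smult smult_right)
lemma zero_left [simp]: "H 0 y = 0" using smult_left[of 0 0 y] by simp
lemma zero_right [simp]: "H y 0 = 0" using smult_right[of y 0 0] by simp
lemma minus_left: "H (- x) y = - H x y" using scaleR_left[of "-1" x y] by simp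
lemma minus_right: "H y (- x) = - H y x" using scaleR_right[of y "-1" x] by simp
lemma diff_left: "H (x - y) z = H x z - H y z"
  using add_left[of x "-y" z] by (simp add: minus_left)
lemma diff_right: "H z (x - y) = H z x - H z y"
  using add_right[of z x "-y"] by (simp add: minus_right)
lemma sum_left: "H (\<Sum>i\<in>S. f i) y = (\<Sum>i\<in>S. H (f i) y)"
  by (induction S rule: infinite_finite_induct) (auto simp: add_left)
lemma sum_right: "H y (\<Sum>i\<in>S. f i) = (\<Sum>i\<in>S. H y (f i))"
  by (induction S rule: infinite_finite_induct) (auto simp: add_right)

lemma nonneg: "Re (H x x) \<ge> 0" using pos[of x] by (cases "x = 0") auto

lemma Re_sym: "Re (H x y) = Re (H y x)" and Im_antisym: "Im (H x y) = - Im (H y x)"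
  using cnj_H[of x y] by simp_all

lemma cauchy_schwarz: "(Re (H x y))\<^sup>2 \<le> Re (H x x) * Re (H y y)"
proof (cases "y = 0")
  case False
  define q b where "q = Re (H y y)" and "b = Re (H x y)"
  \<comment> \<open>The vector is \<open>q\<close> times the component of \<open>x\<close>
    orthogonal to \<open>y\<close> for the real inner product \<open>Re H\<close>; scaling by
    \<open>q\<close> avoids a division.\<close>
  have "0 \<le> Re (H (q *\<^sub>R x - b *\<^sub>R y) (q *\<^sub>R x - b *\<^sub>R y))" by (rule nonneg)
  also have "\<dots> = q * (q * Re (H x x) - b\<^sup>2)"
    using Re_sym[of x y]
    by (simp add: diff_left diff_right scaleR_left scaleR_right q_def[symmetric] b_def[symmetric]
        algebra_simps power2_eq_square)
  finally show ?thesis using pos[OF False] by (simp add: q_def b_def zero_le_mult_iff mult.commute)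
qed simp

text \<open>Multiplying \<open>x\<close> by \<open>i\<close> preserves its norm and turns the
  imaginary part of the pairing into a real part, up to sign.\<close>

lemma cauchy_schwarz_Im: "(Im (H x y))\<^sup>2 \<le> Re (H x x) * Re (H y y)"
  using cauchy_schwarz[of "\<i> *s x" y] by (simp add: smult_left smult_right)

lemma Im_rcomb_left: "Im (H (rcomb a b u v) w) = (\<Sum>i\<in>UNIV. a i * Im (H (u i) w) + b i * Im (H (v i) w))"
  by (simp add: rcomb_def sum_left add_left scaleR_left)
lemma Im_rcomb_right: "Im (H w (rcomb a b u v)) = (\<Sum>i\<in>UNIV. a i * Im (H w (u i)) + b i * Im (H w (v i)))"
  by (simp add: rcomb_def sum_right add_right scaleR_right)

text \<open>The part of \<open>symplectic_basis\<close> that does not mention the lattice. It can be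
  carried along isometries and integral changes of basis by comparing pairings only.\<close>

definition J_basis :: "('n \<Rightarrow> 'n cvec) \<Rightarrow> ('n \<Rightarrow> 'n cvec) \<Rightarrow> bool" where
  "J_basis u v \<longleftrightarrow> (\<forall>i j. Im (H (u i) (u j)) = 0 \<and> Im (H (v i) (v j)) = 0 \<and>
            Im (H (u i) (v j)) = (if i = j then 1 else 0) \<and>
            Im (H (v i) (u j)) = (if i = j then -1 else 0))"

text \<open>Each basis vector pairs nontrivially only with its partner, so a pairing picks out a
  single coefficient. The sign in the second equation is that of the lower left block of
  \<open>J\<close>.\<close>

lemma J_basis_coord:
  assumes "J_basis u v"
  shows "Im (H (rcomb a b u v) (v i)) = a i" "Im (H (rcomb a b u v) (u i)) = - b i"
  using assms
  by (simp_all add: Im_rcomb_left J_basis_def if_distrib[of "\<lambda>x. _ * x"] sum_negf cong: if_cong)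

lemma J_basis_indep:
  assumes "J_basis u v" "rcomb a b u v = 0"
  shows "\<forall>i. a i = 0 \<and> b i = 0"
  using J_basis_coord[OF assms(1), of a b] assms(2) by simp

lemma J_basis_expand:
  assumes "J_basis u v"
  shows "w = rcomb (\<lambda>i. Im (H w (v i))) (\<lambda>i. - Im (H w (u i))) u v"
proof -
  obtain a b where "w = rcomb a b u v" using rcomb_surj[OF J_basis_indep[OF assms]] by blast
  then show ?thesis using J_basis_coord[OF assms, of a b] by simp
qed

lemma J_basis_inj:
  assumes "J_basis u v" "rcomb a b u v = rcomb a' b' u v"
  shows "a = a'" "b = b'"
  using J_basis_coord[OF assms(1), of a b] J_basis_coord[OF assms(1), of a' b'] assms(2)
  by auto

end

text \<open>Coordinates are pairings with the basis, so the integral span consists of the vectors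
  with integral pairings. Membership in the lattice thus becomes a condition on \<open>Im H\<close>
  alone.\<close>

lemma symplectic_basis_iff:
  assumes "pos_def_hermitian H"
  shows "symplectic_basis H L u v \<longleftrightarrow> pd_herm.J_basis H u v \<and>
    L = {w. \<forall>i. Im (H w (v i)) \<in> \<int> \<and> Im (H w (u i)) \<in> \<int>}"
proof -
  interpret pd_herm H using assms by unfold_locales
  have L: "{rcomb (\<lambda>i. of_int (a i)) (\<lambda>i. of_int (b i)) u v | a b :: 'a \<Rightarrow> int. True} =
    {w. \<forall>i. Im (H w (v i)) \<in> \<int> \<and> Im (H w (u i)) \<in> \<int>}" (is "?A = ?B") if J: "J_basis u v"
  proof
    show "?A \<subseteq> ?B" using J_basis_coord[OF J] by auto
    show "?B \<subseteq> ?A"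
    proof
      fix w assume "w \<in> ?B"
      then have "Im (H w (v i)) = of_int \<lfloor>Im (H w (v i))\<rfloor>" "- Im (H w (u i)) = of_int (- \<lfloor>Im (H w (u i))\<rfloor>)" for i
        by (auto elim!: Ints_cases)
      then have "w = rcomb (\<lambda>i. of_int \<lfloor>Im (H w (v i))\<rfloor>) (\<lambda>i. of_int (- \<lfloor>Im (H w (u i))\<rfloor>)) u v"
        using J_basis_expand[OF J, of w] by simp
      then show "w \<in> ?A"
        by (intro CollectI exI[of _ "\<lambda>i. \<lfloor>Im (H w (v i))\<rfloor>"] exI[of _ "\<lambda>i. - \<lfloor>Im (H w (u i))\<rfloor>"] conjI TrueI)
    qed
  qed
  show ?thesis
  proof (cases "J_basis u v")
    case True
    then show ?thesis
      unfolding symplectic_basis_def rcomb_def[symmetric] L[OF True]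
      using J_basis_indep[OF True] by (simp add: J_basis_def)
  next
    case False
    then show ?thesis unfolding symplectic_basis_def J_basis_def by blast
  qed
qed

section \<open>Unimodular lattices and rigidity\<close>

locale symp = pd_herm H for H :: "('n::finite) cvec \<Rightarrow> 'n cvec \<Rightarrow> complex" +
  fixes L :: "'n cvec set" and u v :: "'n \<Rightarrow> 'n cvec"
  assumes sb: "symplectic_basis H L u v"
begin

lemma J: "J_basis u v" and L_eq: "L = {w. \<forall>i. Im (H w (v i)) \<in> \<int> \<and> Im (H w (u i)) \<in> \<int>}"
  using sb symplectic_basis_iff[OF pdh] by blast+

lemma L_add: "x \<in> L \<Longrightarrow> y \<in> L \<Longrightarrow> x + y \<in> L"
  and L_minus: "x \<in> L \<Longrightarrow> - x \<in> L"
  and L_zero: "0 \<in> L"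
  by (simp_all add: L_eq add_left minus_left)

lemma u_L: "u i \<in> L" and v_L: "v i \<in> L"
  using J by (simp_all add: L_eq J_basis_def)

lemma L_int: "k \<in> \<int> \<Longrightarrow> x \<in> L \<Longrightarrow> of_real k *s x \<in> L"
  by (simp add: L_eq smult_left)

lemma rcomb_L: "(\<And>i. a i \<in> \<int>) \<Longrightarrow> (\<And>i. b i \<in> \<int>) \<Longrightarrow> rcomb a b u v \<in> L"
  using J_basis_coord[OF J] by (simp add: L_eq)

lemma Im_int: assumes "x \<in> L" "y \<in> L" shows "Im (H x y) \<in> \<int>"
proof -
  have "Im (H x y) = Im (H x (rcomb (\<lambda>i. Im (H y (v i))) (\<lambda>i. - Im (H y (u i))) u v))"
    using J_basis_expand[OF J, of y] by simp
  also have "\<dots> \<in> \<int>" using assms unfolding Im_rcomb_right L_eq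
    by (intro Ints_sum) auto
  finally show ?thesis .
qed

text \<open>A lattice with a symplectic basis is its own dual under \<open>Im H\<close>. The span of
  the new family lies in \<open>L\<close>, and \<open>L\<close>, pairing integrally with that
  family, lies in the dual of this span, which is the span itself.\<close>

lemma symplectic_basis_change:
  assumes "J_basis u' v'" "\<And>i. u' i \<in> L" "\<And>i. v' i \<in> L"
  shows "symplectic_basis H L u' v'"
proof -
  have 1: "L \<subseteq> {w. \<forall>i. Im (H w (v' i)) \<in> \<int> \<and> Im (H w (u' i)) \<in> \<int>}"
    using assms Im_int by auto
  have 2: "w \<in> L" if w: "\<forall>i. Im (H w (v' i)) \<in> \<int> \<and> Im (H w (u' i)) \<in> \<int>" for w
  proof -
    have uu: "Im (H (u' i) x) \<in> \<int>" "Im (H (v' i) x) \<in> \<int>" if "x \<in> L" for i x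
      using that assms Im_int by auto
    have "Im (H w x) \<in> \<int>" if "x \<in> L" for x
      by (subst J_basis_expand[OF assms(1), of w], unfold Im_rcomb_left)
        (use w uu[OF that] in \<open>intro Ints_sum Ints_add Ints_mult Ints_minus; simp\<close>)
    then show ?thesis using u_L v_L by (simp add: L_eq)
  qed
  show ?thesis unfolding symplectic_basis_iff[OF pdh] using assms(1) 1 2 by auto
qed

lemma rigidity:
  assumes f: "clinear f" and iso: "\<And>x y. H (f x) (f y) = H x y"
    and N: "N \<ge> 4" and lev: "\<And>x. x \<in> L \<Longrightarrow> \<exists>l\<in>L. f x - x = of_nat N *s l"
  shows "f x = x"
proof -
  define h where "h x = (1 / of_nat N) *s (f x - x)" for x
  have Nh: "of_nat N *s h x = f x - x" for x using N by (simp add: h_def)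
  have fh: "f x = x + of_nat N *s h x" for x by (simp add: Nh)
  have hL: "h x \<in> L" if x: "x \<in> L" for x
  proof -
    obtain l where "l \<in> L" "f x - x = of_nat N *s l" using lev[OF x] by blast
    then show ?thesis using N by (simp add: h_def del: vector_ssub_ldistrib)
  qed
  \<comment> \<open>By the parallelogram law and \<open>iso\<close>, the norms of
    \<open>f x + x\<close> and \<open>f x - x\<close> add up to four times the norm of
    \<open>x\<close>. Dividing by \<open>N^2\<close>, which is at least 16, leaves the factor 1/4;
    this is where \<open>N >= 4\<close> enters.\<close>
  have qh: "Re (H (h x) (h x)) \<le> Re (H x x) / 4" for x
  proof -
    have "0 \<le> Re (H (f x + x) (f x + x))" by (rule nonneg)
    then have "Re (H (f x - x) (f x - x)) \<le> 4 * Re (H x x)"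
      using iso[of x x] by (simp add: add_left add_right diff_left diff_right)
    moreover have "Re (H (f x - x) (f x - x)) = (real N)\<^sup>2 * Re (H (h x) (h x))"
      by (simp add: Nh[symmetric] smult_left smult_right power2_eq_square)
    moreover have "16 * Re (H (h x) (h x)) \<le> (real N)\<^sup>2 * Re (H (h x) (h x))"
      using N power_mono[of 4 "real N" 2] by (intro mult_right_mono nonneg) auto
    ultimately show ?thesis by simp
  qed
  have pow: "(h ^^ k) x \<in> L \<and> Re (H ((h ^^ k) x) ((h ^^ k) x)) \<le> (1/4)^k * Re (H x x)" if "x \<in> L" for x k
  proof (induction k)
    case (Suc k)
    then show ?case using hL qh[of "(h ^^ k) x"] by auto
  qed (simp add: that)
  \<comment> \<open>The coordinates of a lattice vector are its pairings with the basis. By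
    Cauchy-Schwarz each is an integer of absolute value less than 1, hence 0.\<close>
  have small: "w = 0" if w: "w \<in> L" and "\<And>y. y \<in> range u \<union> range v \<Longrightarrow> Re (H w w) * Re (H y y) < 1" for w
  proof -
    have "Im (H w y) = 0" if "y \<in> range u \<union> range v" for y
    proof -
      have "(Im (H w y))\<^sup>2 < 1" using cauchy_schwarz_Im[of w y] \<open>\<And>y. y \<in> range u \<union> range v \<Longrightarrow> Re (H w w) * Re (H y y) < 1\<close>[OF that] by simp
      moreover have "Im (H w y) \<in> \<int>" using that w by (auto simp: L_eq)
      ultimately show ?thesis
        using Ints_nonzero_abs_ge1[of "Im (H w y)"] by (force simp: abs_square_less_1)
    qed
    then show "w = 0" using J_basis_expand[OF J, of w] by (simp add: rcomb_def)
  qed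
  have nil: "\<exists>k. (h ^^ k) x = 0" if x: "x \<in> L" for x
  proof -
    \<comment> \<open>\<open>M\<close> dominates the norm of every basis vector. The summand 1 keeps
      it positive, and \<open>q + 1\<close> below likewise keeps the denominator nonzero when
      \<open>q = 0\<close>.\<close>
    define M where "M = 1 + (\<Sum>y\<in>range u \<union> range v. Re (H y y))"
    have M: "M \<ge> 1" unfolding M_def using sum_nonneg[of "range u \<union> range v" "\<lambda>y. Re (H y y)"] nonneg by simp
    have M2: "Re (H y y) \<le> M" if "y \<in> range u \<union> range v" for y
      unfolding M_def using member_le_sum[OF that, of "\<lambda>y. Re (H y y)"] nonneg by simp
    define q where "q = Re (H x x)"
    have q: "q \<ge> 0" by (simp add: q_def nonneg)
    obtain k where k: "(1/4)^k < 1 / (M * (q + 1))"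
      using real_arch_pow_inv[of "1 / (M * (q + 1))" "1/4"] M q by auto
    have "(h ^^ k) x = 0"
    proof (rule small)
      fix y assume y: "y \<in> range u \<union> range v"
      have "Re (H ((h ^^ k) x) ((h ^^ k) x)) * Re (H y y) \<le> ((1/4)^k * q) * M"
        using pow[OF x, of k] M2[OF y] nonneg q by (intro mult_mono) (auto simp: q_def)
      also have "\<dots> \<le> (1/4)^k * (M * (q + 1))" using M by (simp add: algebra_simps)
      also have "\<dots> < 1" using k M q by (simp add: pos_less_divide_eq)
      finally show "Re (H ((h ^^ k) x) ((h ^^ k) x)) * Re (H y y) < 1" .
    qed (use pow[OF x] in auto)
    then show ?thesis ..
  qed
  \<comment> \<open>If \<open>h (h y) = 0\<close>, then \<open>f\<close> fixes \<open>h y\<close>.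
    Comparing the pairing of \<open>f y = y + N h y\<close> with \<open>f (h y) = h y\<close> to
    that of \<open>y\<close> with \<open>h y\<close> leaves \<open>N\<close> times the norm of
    \<open>h y\<close> equal to 0.\<close>
  have step: "h y = 0" if "h (h y) = 0" for y
  proof (rule ccontr)
    assume "h y \<noteq> 0"
    have "f (h y) = h y" using fh[of "h y"] that by simp
    then have "H (y + of_nat N *s h y) (h y) = H y (h y)" using iso[of y "h y"] fh[of y] by simp
    then have "of_nat N * H (h y) (h y) = 0" by (simp add: add_left smult_left)
    then show False using N pos[OF \<open>h y \<noteq> 0\<close>] by auto
  qed
  have red: "(h ^^ Suc k) y = 0 \<Longrightarrow> h y = 0" for k y
    by (induction k) (use step in auto)
  have h0: "h x = 0" if x: "x \<in> L" for x
  proof -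
    obtain k where "(h ^^ k) x = 0" using nil[OF x] ..
    \<comment> \<open>This raises the exponent by one, so that \<open>red\<close> applies even if
      the vanishing power is \<open>k = 0\<close>.\<close>
    moreover have "h 0 = 0" by (simp add: h_def clinear_0[OF f])
    ultimately show ?thesis using red[of k x] by simp
  qed
  have fL: "f x = x" if "x \<in> L" for x using fh[of x] h0[OF that] by simp
  \<comment> \<open>The lattice spans \<open>C^n\<close> over the reals, so a linear map fixing the
    lattice is the identity.\<close>
  have "f x = f (rcomb (\<lambda>i. Im (H x (v i))) (\<lambda>i. - Im (H x (u i))) u v)" 
    using J_basis_expand[OF J, of x] by simp
  also have "\<dots> = rcomb (\<lambda>i. Im (H x (v i))) (\<lambda>i. - Im (H x (u i))) u v"
    by (simp add: clinear_rcomb[OF f] fL u_L v_L)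
  finally show ?thesis using J_basis_expand[OF J, of x] by simp
qed

end

section \<open>The Siegel space and period matrices\<close>

lemma matrix_inv_works:
  assumes "invertible A"
  shows "A ** matrix_inv A = mat 1" "matrix_inv A ** A = mat 1"
  using someI_ex[OF assms[unfolded invertible_def]] by (auto simp: matrix_inv_def)

lemma matrix_inv_eqI:
  assumes "A ** B = mat 1" "B ** A = mat 1"
  shows "matrix_inv A = B"
proof -
  have "invertible A" using assms by (auto simp: invertible_def)
  have "matrix_inv A = matrix_inv A ** (A ** B)" using assms by simp
  also have "\<dots> = B" by (simp add: matrix_mul_assoc matrix_inv_works[OF \<open>invertible A\<close>])
  finally show ?thesis .
qed

text \<open>The sesquilinear form with an arbitrary real Gram matrix. Separating the matrix from
  \<open>ImM Z\<close> lets an unknown form be written this way before it is identified with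
  \<open>H_Z\<close>.\<close>

definition sesq :: "real^'n^'n \<Rightarrow> ('n::finite) cvec \<Rightarrow> 'n cvec \<Rightarrow> complex" where
  "sesq S x y = (\<Sum>i\<in>UNIV. \<Sum>j\<in>UNIV. x $ i * complex_of_real (S $ i $ j) * cnj (y $ j))"

definition ReM :: "('n::finite) cmat \<Rightarrow> real^'n^'n" where
  "ReM Z = (\<chi> i j. Re (Z $ i $ j))"

abbreviation unitv :: "'n \<Rightarrow> ('n::finite) cvec" where
  "unitv j \<equiv> axis j 1"

lemma matrix_vector_mult_unitv: "A *v unitv i = column i A"
  by (simp add: vec_eq_iff matrix_vector_mult_def axis_def column_def if_distrib[of "\<lambda>x. _ * x"] cong: if_cong)

lemma H_Z_eq_sesq: "H_Z Z = sesq (matrix_inv (ImM Z))"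
  by (simp add: fun_eq_iff H_Z_def sesq_def)

lemma sesq_unitv_right: "sesq S x (unitv j) = (\<Sum>i\<in>UNIV. x $ i * of_real (S $ i $ j))"
  by (simp add: sesq_def axis_def if_distrib[of cnj] if_distrib[of "\<lambda>x. _ * x"] cong: if_cong)

lemma sesq_unitv_left: "sesq S (unitv i) y = (\<Sum>j\<in>UNIV. of_real (S $ i $ j) * cnj (y $ j))"
  unfolding sesq_def by (subst sum.swap)
    (simp add: axis_def if_distrib[of "\<lambda>x. x * _"] cong: if_cong)

lemma sesq_unitv: "sesq S (unitv i) (unitv j) = of_real (S $ i $ j)"
  unfolding sesq_unitv_right by (simp add: axis_def if_distrib[of "\<lambda>x. x * _"] cong: if_cong)

text \<open>With \<open>Z = X + iY\<close>, this and the next two formulas turn the symplectic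
  conditions on the columns of \<open>Z\<close> and the unit vectors into matrix identities between
  \<open>X\<close>, \<open>Y\<close> and \<open>S\<close>. They serve both to verify these
  conditions and to extract the Riemann relations from them.\<close>

lemma Im_sesq_column_unitv: "Im (sesq S (column i Z) (unitv j)) = (transpose (ImM Z) ** S) $ i $ j"
  by (simp add: sesq_unitv_right matrix_matrix_mult_def transpose_def ImM_def column_def)

lemma Im_sesq_unitv_column: "Im (sesq S (unitv i) (column j Z)) = - (S ** ImM Z) $ i $ j"
  by (simp add: sesq_unitv_left matrix_matrix_mult_def ImM_def column_def sum_negf)

lemma Im_sesq_column_column: "Im (sesq S (column i Z) (column j Z)) =
    (transpose (ImM Z) ** S ** ReM Z - transpose (ReM Z) ** (S ** ImM Z)) $ i $ j"
proof -
  have "(transpose (ImM Z) ** S ** ReM Z) $ i $ j =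
      (\<Sum>k\<in>UNIV. \<Sum>l\<in>UNIV. Im (Z $ k $ i) * S $ k $ l * Re (Z $ l $ j))"
    unfolding matrix_matrix_mult_def
    by (subst sum.swap) (simp add: transpose_def ImM_def ReM_def sum_distrib_right)
  moreover have "(transpose (ReM Z) ** (S ** ImM Z)) $ i $ j =
      (\<Sum>k\<in>UNIV. \<Sum>l\<in>UNIV. Re (Z $ k $ i) * S $ k $ l * Im (Z $ l $ j))"
    unfolding matrix_matrix_mult_def
    by (simp add: transpose_def ImM_def ReM_def sum_distrib_left mult.assoc)
  ultimately show ?thesis
    by (simp add: sesq_def column_def sum_subtractf[symmetric] algebra_simps)
qed

lemma Re_sesq_diag: "Re (sesq S x x) = (\<chi> i. Re (x $ i)) \<bullet> (S *v (\<chi> i. Re (x $ i)))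
    + (\<chi> i. Im (x $ i)) \<bullet> (S *v (\<chi> i. Im (x $ i)))"
  by (simp add: sesq_def inner_vec_def matrix_vector_mult_def sum_distrib_left sum.distrib[symmetric] algebra_simps)

lemma cnj_sesq: "transpose S = S \<Longrightarrow> sesq S y x = cnj (sesq S x y)"
proof -
  assume "transpose S = S"
  then have S: "S $ i $ j = S $ j $ i" for i j unfolding transpose_def vec_eq_iff by simp
  have "sesq S y x = (\<Sum>j\<in>UNIV. \<Sum>i\<in>UNIV. y $ i * complex_of_real (S $ i $ j) * cnj (x $ j))"
    unfolding sesq_def by (rule sum.swap)
  also have "\<dots> = cnj (sesq S x y)"
    unfolding sesq_def cnj_sum by (intro sum.cong refl) (simp add: S mult.commute mult.left_commute)
  finally show ?thesis .
qed

lemma pos_def_hermitian_sesq: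
  assumes "transpose S = S" "\<And>x. x \<noteq> 0 \<Longrightarrow> x \<bullet> (S *v x) > 0"
  shows "pos_def_hermitian (sesq S)"
  unfolding pos_def_hermitian_def
proof (intro conjI allI impI)
  show "sesq S (u + v) w = sesq S u w + sesq S v w" for u v w
    by (simp add: sesq_def algebra_simps sum.distrib)
  show "sesq S (c *s u) v = c * sesq S u v" for c u v
    by (simp add: sesq_def sum_distrib_left mult.assoc)
  show c: "sesq S v u = cnj (sesq S u v)" for u v using cnj_sesq[OF assms(1)] .
  fix x :: "'a cvec" assume x: "x \<noteq> 0"
  show "Im (sesq S x x) = 0" using c[of x x] by (simp add: complex_eq_iff)
  have nn: "y \<bullet> (S *v y) \<ge> 0" for y using assms(2)[of y] by (cases "y = 0") auto
  have "(\<chi> i. Re (x $ i)) \<noteq> 0 \<or> (\<chi> i. Im (x $ i)) \<noteq> 0"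
    using x by (auto simp: vec_eq_iff complex_eq_iff)
  then show "Re (sesq S x x) > 0" unfolding Re_sesq_diag
    using nn assms(2) by (auto intro: add_pos_nonneg add_nonneg_pos)
qed

lemma F_Z_eq_rcomb: "F_Z Z x y = rcomb (\<lambda>i. x $ i) (\<lambda>i. y $ i) (\<lambda>i. column i Z) unitv"
  by (simp add: F_Z_def rcomb_def vec_eq_iff sum.distrib matrix_vector_mult_def column_def axis_def
      scaleR_conv_of_real[where 'a=complex] if_distrib[of "\<lambda>x. _ * x"] mult.commute cong: if_cong)

lemma L_Z_eq: "L_Z Z = {rcomb (\<lambda>i. of_int (a i)) (\<lambda>i. of_int (b i)) (\<lambda>i. column i Z) unitv | a b. True}"
proof (intro equalityI subsetI)
  fix w assume "w \<in> L_Z Z"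
  then obtain x y where w: "w = F_Z Z x y" and i: "\<forall>i. x $ i \<in> \<int> \<and> y $ i \<in> \<int>"
    unfolding L_Z_def by auto
  from i have "x $ i = of_int \<lfloor>x $ i\<rfloor>" "y $ i = of_int \<lfloor>y $ i\<rfloor>" for i by auto
  then have "w = rcomb (\<lambda>i. of_int \<lfloor>x $ i\<rfloor>) (\<lambda>i. of_int \<lfloor>y $ i\<rfloor>) (\<lambda>i. column i Z) unitv"
    unfolding w F_Z_eq_rcomb by simp
  then show "w \<in> {rcomb (\<lambda>i. of_int (a i)) (\<lambda>i. of_int (b i)) (\<lambda>i. column i Z) unitv | a b. True}"
    by (intro CollectI exI[of _ "\<lambda>i. \<lfloor>x $ i\<rfloor>"] exI[of _ "\<lambda>i. \<lfloor>y $ i\<rfloor>"] conjI TrueI)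
next
  fix w assume "w \<in> {rcomb (\<lambda>i. of_int (a i)) (\<lambda>i. of_int (b i)) (\<lambda>i. column i Z) unitv | a b. True}"
  then obtain a b where "w = rcomb (\<lambda>i. of_int (a i)) (\<lambda>i. of_int (b i)) (\<lambda>i. column i Z) unitv" by blast
  then have "w = F_Z Z (\<chi> i. of_int (a i)) (\<chi> i. of_int (b i))" by (simp add: F_Z_eq_rcomb)
  then show "w \<in> L_Z Z" unfolding L_Z_def by (intro CollectI exI conjI allI) auto
qed

section \<open>The correspondence between Siegel points and polarized lattices\<close>

lemma siegel_sym: "Z \<in> siegel \<Longrightarrow> transpose Z = Z"
  and siegel_pos: "Z \<in> siegel \<Longrightarrow> x \<noteq> 0 \<Longrightarrow> x \<bullet> (ImM Z *v x) > 0"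
  by (auto simp: siegel_def)

lemma siegel_ImM:
  assumes "Z \<in> siegel"
  shows "transpose (ImM Z) = ImM Z" "transpose (ReM Z) = ReM Z"
    "matrix_inv (ImM Z) ** ImM Z = mat 1" "ImM Z ** matrix_inv (ImM Z) = mat 1"
    "transpose (matrix_inv (ImM Z)) = matrix_inv (ImM Z)"
proof -
  have Z: "Z $ i $ j = Z $ j $ i" for i j using siegel_sym[OF assms] unfolding transpose_def vec_eq_iff by simp
  show s: "transpose (ImM Z) = ImM Z" "transpose (ReM Z) = ReM Z"
    using Z by (simp_all add: transpose_def ImM_def ReM_def vec_eq_iff)
  have "invertible (ImM Z)"
    unfolding invertible_left_inverse matrix_left_invertible_ker
  proof (intro allI impI)
    fix x assume "ImM Z *v x = 0" then show "x = 0" using siegel_pos[OF assms, of x] by auto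
  qed
  then show i: "matrix_inv (ImM Z) ** ImM Z = mat 1" "ImM Z ** matrix_inv (ImM Z) = mat 1"
    by (simp_all add: matrix_inv_works)
  have "transpose (matrix_inv (ImM Z)) ** ImM Z = mat 1"
    using arg_cong[OF i(2), of transpose] by (simp add: matrix_transpose_mul s transpose_mat)
  then have "transpose (matrix_inv (ImM Z)) ** ImM Z ** matrix_inv (ImM Z) = matrix_inv (ImM Z)" by simp
  then show "transpose (matrix_inv (ImM Z)) = matrix_inv (ImM Z)"
    using i(2) by (simp add: matrix_mul_assoc[symmetric])
qed

lemma siegel_herm:
  assumes "Z \<in> siegel"
  shows "pos_def_hermitian (H_Z Z)"
  unfolding H_Z_eq_sesq
proof (rule pos_def_hermitian_sesq)
  show "transpose (matrix_inv (ImM Z)) = matrix_inv (ImM Z)" using siegel_ImM(5)[OF assms] .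
  fix x :: "real^'a" assume "x \<noteq> 0"
  \<comment> \<open>Substituting \<open>x = ImM Z *v y\<close> turns the inverse quadratic form at
    \<open>x\<close> into the form of \<open>ImM Z\<close> at \<open>y\<close>.\<close>
  define y where "y = matrix_inv (ImM Z) *v x"
  have x: "x = ImM Z *v y" using siegel_ImM(4)[OF assms] by (simp add: y_def matrix_vector_mul_assoc)
  then have "y \<noteq> 0" using \<open>x \<noteq> 0\<close> by auto
  then have "y \<bullet> x > 0" using siegel_pos[OF assms] x by simp
  then show "x \<bullet> (matrix_inv (ImM Z) *v x) > 0" by (simp add: y_def inner_commute)
qed

lemma siegel_symplectic_basis:
  assumes "Z \<in> siegel"
  shows "symplectic_basis (H_Z Z) (L_Z Z) (\<lambda>i. column i Z) unitv"
proof -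
  interpret pd_herm "H_Z Z" using siegel_herm[OF assms] by unfold_locales
  note s = siegel_ImM[OF assms]
  have J: "J_basis (\<lambda>i. column i Z) unitv"
    unfolding J_basis_def unfolding H_Z_eq_sesq Im_sesq_column_column Im_sesq_column_unitv Im_sesq_unitv_column sesq_unitv
    by (simp add: s) (simp add: mat_def)
  show ?thesis using J_basis_indep[OF J] J
    unfolding symplectic_basis_def rcomb_def[symmetric] J_basis_def L_Z_eq by blast
qed

lemma siegel_symp: "Z \<in> siegel \<Longrightarrow> symp (H_Z Z) (L_Z Z) (\<lambda>i. column i Z) unitv"
  by (simp add: symp_def symp_axioms_def pd_herm_def siegel_herm siegel_symplectic_basis)

text \<open>The Riemann relations. The Gram matrix \<open>S\<close> of the unit vectors is real
  because their imaginary pairings vanish; the remaining pairings make \<open>S\<close> the inverse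
  of \<open>ImM Z\<close> and force \<open>Z\<close> to be symmetric, and positivity of
  \<open>H\<close> gives positivity of \<open>ImM Z\<close>.\<close>

lemma siegel_of_symplectic_basis:
  assumes H: "pos_def_hermitian H" and sb: "symplectic_basis H L (\<lambda>i. column i Z) unitv"
  shows "Z \<in> siegel" "H = H_Z Z" "L = L_Z Z"
proof -
  interpret symp H L "\<lambda>i. column i Z" unitv using H sb by unfold_locales
  show "L = L_Z Z" using sb unfolding symplectic_basis_def L_Z_eq rcomb_def by blast
  define S :: "real^'a^'a" where "S = (\<chi> i j. Re (H (unitv i) (unitv j)))"
  have HS: "H = sesq S"
  proof (intro ext)
    fix x y
    have "H x y = H (\<Sum>i\<in>UNIV. x $ i *s unitv i) (\<Sum>j\<in>UNIV. y $ j *s unitv j)"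
      by (simp only: basis_expansion)
    also have "\<dots> = (\<Sum>i\<in>UNIV. \<Sum>j\<in>UNIV. x $ i * H (unitv i) (unitv j) * cnj (y $ j))"
      unfolding sum_left sum_right smult_left smult_right
      by (subst sum.swap) (simp add: sum_distrib_left mult.commute mult.left_commute)
    also have "\<dots> = sesq S x y"
      unfolding sesq_def using J
      by (intro sum.cong refl) (simp add: S_def J_basis_def complex_eq_iff)
    finally show "H x y = sesq S x y" .
  qed
  note j = J[unfolded J_basis_def, unfolded HS Im_sesq_column_column Im_sesq_column_unitv Im_sesq_unitv_column]
  have "- (S ** ImM Z) $ i $ j = (if i = j then -1 else 0)" for i j using j by blast
  then have j': "(S ** ImM Z) $ i $ j = (if i = j then 1 else 0)" for i j
    by (metis minus_equation_iff minus_zero)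
  have 1: "transpose (ImM Z) ** S = mat 1" and 2: "S ** ImM Z = mat 1"
    and 3: "transpose (ImM Z) ** S ** ReM Z - transpose (ReM Z) ** (S ** ImM Z) = 0"
    unfolding vec_eq_iff using j j' by (auto simp: mat_def)
  \<comment> \<open>Regrouping this product with \<open>S ** ImM Z = mat 1\<close> gives the
    transpose of \<open>ImM Z\<close> instead.\<close>
  have "transpose (ImM Z) ** S ** ImM Z = ImM Z" using 1 by simp
  then have sY: "transpose (ImM Z) = ImM Z" using 2 by (simp add: matrix_mul_assoc[symmetric])
  have sX: "transpose (ReM Z) = ReM Z" using 3 1 2 by simp
  have sZ: "transpose Z = Z"
  proof -
    have "Re (transpose Z $ i $ j) = transpose (ReM Z) $ i $ j" "Im (transpose Z $ i $ j) = transpose (ImM Z) $ i $ j" for i j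
      by (simp_all add: transpose_def ReM_def ImM_def)
    then show ?thesis unfolding sX sY by (simp add: vec_eq_iff complex_eq_iff ReM_def ImM_def)
  qed
  have "matrix_inv (ImM Z) = S" using 1 2 sY by (intro matrix_inv_eqI) auto
  then show "H = H_Z Z" by (simp add: HS H_Z_eq_sesq)
  show "Z \<in> siegel" unfolding siegel_def
  proof (intro CollectI conjI allI impI sZ)
    fix x :: "real^'a" assume x: "x \<noteq> 0"
    \<comment> \<open>The form at the real vector \<open>y\<close> is
      \<open>y \<bullet> (S *v y)\<close>, and \<open>S *v y = x\<close>, so it equals the quadratic
      form of \<open>ImM Z\<close> at \<open>x\<close>.\<close>
    define y where "y = ImM Z *v x"
    have Sy: "S *v y = x" by (simp add: y_def matrix_vector_mul_assoc 2)
    then have "y \<noteq> 0" using x by auto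
    then have "(\<chi> i. complex_of_real (y $ i)) \<noteq> 0" by (auto simp: vec_eq_iff)
    from pos[OF this] show "x \<bullet> (ImM Z *v x) > 0"
      unfolding HS Re_sesq_diag by (simp add: Sy inner_commute y_def[symmetric] zero_vec_def[symmetric])
  qed
qed

text \<open>The vectors \<open>v i\<close> form a complex basis, so a complex linear change of
  coordinates \<open>f\<close> makes them the unit vectors. The images of the \<open>u i\<close> are
  then the columns of the period matrix, and the transported form \<open>H'\<close> satisfies the
  Riemann relations.\<close>

lemma (in symp) period:
  obtains Z f where "Z \<in> siegel" "clinear f" "bij f" "\<And>i. f (u i) = column i Z" "\<And>i. f (v i) = unitv i"
    "f ` L = L_Z Z" "\<And>x y. H_Z Z (f x) (f y) = H x y"
proof -
  define W :: "'n cmat" where "W = (\<chi> k j. v j $ k)"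
  have W: "W *v x = (\<Sum>j\<in>UNIV. x $ j *s v j)" for x
    by (simp add: vec_eq_iff matrix_vector_mult_def W_def mult.commute)
  have "x = 0" if "W *v x = 0" for x
  proof -
    \<comment> \<open>Splitting the coefficients into real and imaginary parts gives
      \<open>w + i w' = 0\<close> with \<open>w\<close> and \<open>w'\<close> in the real span of
      the \<open>v i\<close>. \<open>Im H\<close> vanishes on that span, and
      \<open>w = -i w'\<close> makes the norm of \<open>w\<close> such an imaginary part.\<close>
    define w w' where "w = rcomb (\<lambda>_. 0) (\<lambda>i. Re (x $ i)) u v" and "w' = rcomb (\<lambda>_. 0) (\<lambda>i. Im (x $ i)) u v"
    have c: "x $ i = of_real (Re (x $ i)) + \<i> * of_real (Im (x $ i))" for i by (simp add: complex_eq_iff)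
    have "0 = (\<Sum>j\<in>UNIV. x $ j *s v j)" by (simp add: that flip: W)
    also have "\<dots> = (\<Sum>j\<in>UNIV. of_real (Re (x $ j)) *s v j + (\<i> * of_real (Im (x $ j))) *s v j)"
      by (intro sum.cong refl) (subst c, simp only: vector_sadd_rdistrib)
    also have "\<dots> = w + \<i> *s w'"
      by (simp add: w_def w'_def rcomb_def scaleR_eq_smult sum.distrib vec.scale_sum_right)
    finally have "0 = w + \<i> *s w'" .
    then have w: "w = (-\<i>) *s w'" by (simp add: vector_smult_lneg eq_neg_iff_add_eq_0)
    have "Re (H w w) = Im (H w' w)" by (subst (1) w) (simp add: smult_left minus_left)
    also have "\<dots> = 0" using J
      unfolding w_def w'_def Im_rcomb_left Im_rcomb_right by (simp add: J_basis_def)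
    finally have "w = 0" using pos[of w] by auto
    moreover from this have "w' = 0" using w by simp
    ultimately show "x = 0"
      using J_basis_indep[OF J, of "\<lambda>_. 0" "\<lambda>i. Re (x $ i)"] J_basis_indep[OF J, of "\<lambda>_. 0" "\<lambda>i. Im (x $ i)"]
      unfolding w_def w'_def by (simp add: vec_eq_iff complex_eq_iff)
  qed
  then have inv: "invertible W" unfolding invertible_left_inverse matrix_left_invertible_ker by blast
  define V where "V = matrix_inv W"
  have VW: "V ** W = mat 1" "W ** V = mat 1" using inv by (simp_all add: V_def matrix_inv_works)
  have VW': "V *v (W *v x) = x" "W *v (V *v x) = x" for x by (simp_all add: matrix_vector_mul_assoc VW)
  define f where "f x = V *v x" for x
  have f: "clinear f" using clinear_matrix_vector_mult[of V] by (simp add: f_def[abs_def])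
  have bij: "bij f" by (rule bij_betw_byWitness[of _ "\<lambda>x. W *v x"]) (auto simp: f_def VW')
  have "W *v unitv i = v i" for i by (simp add: matrix_vector_mult_unitv) (simp add: column_def W_def vec_eq_iff)
  then have fv: "f (v i) = unitv i" for i using VW'(1)[of "unitv i"] by (simp add: f_def)
  define Z :: "'n cmat" where "Z = (\<chi> k i. f (u i) $ k)"
  have fu: "f (u i) = column i Z" for i by (simp add: Z_def column_def vec_eq_iff)
  define H' where "H' x y = H (W *v x) (W *v y)" for x y
  have Hf: "H' (f x) (f y) = H x y" for x y by (simp add: H'_def f_def VW')
  have H': "pos_def_hermitian H'"
    unfolding pos_def_hermitian_def
  proof (intro conjI allI impI)
    fix x :: "'n cvec" assume "x \<noteq> 0"
    then have "W *v x \<noteq> 0" using VW'(1)[of x] by auto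
    then show "0 < Re (H' x x)" "Im (H' x x) = 0" using pos Im_antisym[of "W *v x" "W *v x"] by (simp_all add: H'_def)
  qed (simp_all add: H'_def matrix_vector_right_distrib vector_scalar_commute add_left smult_left cnj_H[symmetric])
  interpret H': pd_herm H' using H' by unfold_locales
  have "H'.J_basis (\<lambda>i. column i Z) unitv"
    using J unfolding H'.J_basis_def J_basis_def fv[symmetric] fu[symmetric] Hf .
  moreover have "f ` L = {w. \<forall>i. Im (H' w (unitv i)) \<in> \<int> \<and> Im (H' w (column i Z)) \<in> \<int>}"
  proof -
    have *: "f x \<in> {w. \<forall>i. Im (H' w (unitv i)) \<in> \<int> \<and> Im (H' w (column i Z)) \<in> \<int>} \<longleftrightarrow> x \<in> L" for x
      unfolding fv[symmetric] fu[symmetric] L_eq by (simp add: Hf)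
    show ?thesis
    proof (intro equalityI subsetI)
      fix w assume "w \<in> {w. \<forall>i. Im (H' w (unitv i)) \<in> \<int> \<and> Im (H' w (column i Z)) \<in> \<int>}"
      moreover obtain x where "w = f x" using bij_is_surj[OF bij] by blast
      ultimately show "w \<in> f ` L" using * by blast
    qed (use * in blast)
  qed
  ultimately have "symplectic_basis H' (f ` L) (\<lambda>i. column i Z) unitv"
    unfolding symplectic_basis_iff[OF H'] by blast
  note P = siegel_of_symplectic_basis[OF H' this]
  show thesis by (rule that[OF P(1) f bij fu fv P(3)]) (simp add: P(2)[symmetric] Hf)
qed

section \<open>Integral symplectic changes of basis\<close>

definition real_mat :: "int^'n^'n \<Rightarrow> real^'n^('n::finite)" where
  "real_mat M = (\<chi> i j. of_int (M $ i $ j))"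

lemma real_mat_simps:
  "real_mat (A ** B) = real_mat A ** real_mat B" "real_mat (A - B) = real_mat A - real_mat B"
  "real_mat (transpose A) = transpose (real_mat A)" "real_mat (mat 1) = mat 1"
  "real_mat 0 = 0" "real_mat (- A) = - real_mat A" "real_mat A = real_mat B \<longleftrightarrow> A = B"
  by (auto simp: real_mat_def vec_eq_iff matrix_matrix_mult_def transpose_def mat_def)

text \<open>The block matrix acting on \<open>R^n x R^n\<close>. Over the reals, finite dimension
  makes a left inverse a right inverse, which exchanges the two forms of the symplectic
  condition.\<close>

definition block_map :: "real^'n^'n \<Rightarrow> real^'n^'n \<Rightarrow> real^'n^'n \<Rightarrow> real^'n^'n \<Rightarrow>
    (real^('n::finite)) \<times> (real^'n) \<Rightarrow> (real^'n) \<times> (real^'n)" where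
  "block_map A B C D p = (A *v fst p + B *v snd p, C *v fst p + D *v snd p)"

lemma linear_block_map: "linear (block_map A B C D)"
  by (rule linearI)
    (simp_all add: block_map_def matrix_vector_right_distrib scaleR_matrix_vector_assoc[symmetric]
      matrix_vector_mult_scaleR scaleR_right_distrib)

lemma block_map_comp: "block_map A B C D \<circ> block_map A' B' C' D' =
    block_map (A ** A' + B ** C') (A ** B' + B ** D') (C ** A' + D ** C') (C ** B' + D ** D')"
  by (simp add: fun_eq_iff block_map_def matrix_vector_right_distrib matrix_vector_mul_assoc
      matrix_vector_mult_add_rdistrib)

lemma block_map_eq_id: "block_map A B C D = id \<longleftrightarrow> A = mat 1 \<and> B = 0 \<and> C = 0 \<and> D = mat 1"
proof
  assume i: "block_map A B C D = id"
  have "A *v x + B *v y = x \<and> C *v x + D *v y = y" for x y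
    using fun_cong[OF i, of "(x, y)"] by (simp add: block_map_def)
  from this[of _ 0] this[of 0] show "A = mat 1 \<and> B = 0 \<and> C = 0 \<and> D = mat 1"
    by (simp add: matrix_eq)
qed (simp add: block_map_def fun_eq_iff)

text \<open>The defining equations say that \<open>(D\<^sup>t, -B\<^sup>t; -C\<^sup>t, A\<^sup>t)\<close> is a left inverse of \<open>(A, B; C, D)\<close>;
  the equations below say that it is a right inverse.\<close>

lemma Sp_int_iff: "(A, B, C, D) \<in> Sp_int \<longleftrightarrow>
    A ** transpose B - B ** transpose A = 0 \<and> A ** transpose D - B ** transpose C = mat 1 \<and>
    C ** transpose D - D ** transpose C = 0 \<and> C ** transpose B - D ** transpose A = - mat 1"
proof -
  let ?a = "real_mat A" and ?b = "real_mat B" and ?c = "real_mat C" and ?d = "real_mat D"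
  let ?f = "block_map ?a ?b ?c ?d"
  let ?g = "block_map (transpose ?d) (- transpose ?b) (- transpose ?c) (transpose ?a)"
  have neg: "(- P) ** Q = - (P ** Q)" "P ** (- Q) = - (P ** Q)" for P Q :: "real^'a^'a"
    by (simp_all add: matrix_matrix_mult_def vec_eq_iff sum_negf)
  have grp: "- x + y = y - x" "x + - y = x - y" "x - y = mat 1 \<longleftrightarrow> y - x = - mat 1" "x - y = 0 \<longleftrightarrow> y - x = 0"
    for x y :: "real^'a^'a"
    by (auto simp: minus_diff_eq[symmetric, of y x] simp del: minus_diff_eq)
  have "(A, B, C, D) \<in> Sp_int \<longleftrightarrow>
      transpose ?a ** ?c - transpose ?c ** ?a = 0 \<and> transpose ?a ** ?d - transpose ?c ** ?b = mat 1 \<and>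
      transpose ?b ** ?c - transpose ?d ** ?a = - mat 1 \<and> transpose ?b ** ?d - transpose ?d ** ?b = 0"
    unfolding real_mat_simps(1-6)[symmetric] real_mat_simps(7) by (simp add: Sp_int_def)
  also have "\<dots> \<longleftrightarrow> ?g \<circ> ?f = id"
    unfolding block_map_comp block_map_eq_id neg grp(1,2)
    using grp(3)[of "transpose ?d ** ?a" "transpose ?b ** ?c"] grp(4)[of "transpose ?d ** ?b" "transpose ?b ** ?d"]
    by blast
  also have "\<dots> \<longleftrightarrow> ?f \<circ> ?g = id"
    using linear_inverse_left[OF linear_block_map linear_block_map] by blast
  also have "\<dots> \<longleftrightarrow> ?a ** transpose ?b - ?b ** transpose ?a = 0 \<and> ?a ** transpose ?d - ?b ** transpose ?c = mat 1 \<and>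
    ?c ** transpose ?d - ?d ** transpose ?c = 0 \<and> ?c ** transpose ?b - ?d ** transpose ?a = - mat 1"
    unfolding block_map_comp block_map_eq_id neg grp(1,2)
    using grp(3)[of "?d ** transpose ?a" "?c ** transpose ?b"] grp(4)[of "?a ** transpose ?b" "?b ** transpose ?a"]
    by blast
  also have "\<dots> \<longleftrightarrow> A ** transpose B - B ** transpose A = 0 \<and> A ** transpose D - B ** transpose C = mat 1 \<and>
    C ** transpose D - D ** transpose C = 0 \<and> C ** transpose B - D ** transpose A = - mat 1"
    unfolding real_mat_simps(1-6)[symmetric] real_mat_simps(7) ..
  finally show ?thesis .
qed

section \<open>Integral combinations and congruences modulo \<open>N L\<close>\<close>

lemma (in pd_herm) Im_rcomb_rcomb:
  assumes "J_basis u v"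
  shows "Im (H (rcomb a b u v) (rcomb a' b' u v)) = (\<Sum>i\<in>UNIV. a i * b' i - b i * a' i)"
proof -
  have 1: "Im (H (u i) (rcomb a' b' u v)) = b' i" for i
    using assms by (simp add: Im_rcomb_right J_basis_def if_distrib[of "\<lambda>x. _ * x"] cong: if_cong)
  have 2: "Im (H (v i) (rcomb a' b' u v)) = - a' i" for i
    using assms by (simp add: Im_rcomb_right J_basis_def if_distrib[of "\<lambda>x. _ * x"] cong: if_cong)
  show ?thesis by (simp add: Im_rcomb_left 1 2)
qed

text \<open>The coefficients are the \<open>i\<close>-th rows of the blocks, so
  \<open>(A, B, C, D)\<close> changes the basis to \<open>u' = A u + B v\<close>,
  \<open>v' = C u + D v\<close>.\<close>

definition int_comb :: "int^'n^'n \<Rightarrow> int^'n^'n \<Rightarrow> ('n \<Rightarrow> 'n cvec) \<Rightarrow> ('n \<Rightarrow> 'n cvec) \<Rightarrow> 'n \<Rightarrow> ('n::finite) cvec" where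
  "int_comb A B u v i = rcomb (\<lambda>j. of_int (A $ i $ j)) (\<lambda>j. of_int (B $ i $ j)) u v"

text \<open>With \<open>g\<close> the block matrix, the new family has Gram matrix
  \<open>g J g^t\<close>, so the pairing conditions say \<open>g J g^t = J\<close>;
  \<open>Sp_int_iff\<close> converts this into the defining condition
  \<open>g^t J g = J\<close>.\<close>

lemma (in pd_herm) J_basis_int_comb_iff:
  assumes "J_basis u v"
  shows "J_basis (int_comb A B u v) (int_comb C D u v) \<longleftrightarrow> (A, B, C, D) \<in> Sp_int"
proof -
  have I: "Im (H (int_comb P Q u v i) (int_comb P' Q' u v j)) = of_int ((P ** transpose Q' - Q ** transpose P') $ i $ j)" for P Q P' Q' i j
    unfolding int_comb_def Im_rcomb_rcomb[OF assms]
    by (simp add: matrix_matrix_mult_def transpose_def sum_subtractf)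
  have e: "real_of_int x = (if b then 1 else 0) \<longleftrightarrow> x = (if b then 1 else 0)"
     "real_of_int x = (if b then -1 else 0) \<longleftrightarrow> x = (if b then -1 else 0)" for x b by auto
  show ?thesis unfolding J_basis_def I Sp_int_iff e of_int_eq_0_iff
    by (simp only: vec_eq_iff mat_def vec_lambda_beta zero_index vector_uminus_component) (auto split: if_splits)
qed

text \<open>Congruence modulo \<open>N L\<close>. Multiplied by \<open>N\<close>, equality of
  \<open>N\<close>-torsion points becomes a congruence of lattice vectors, which adds and scales
  like one of integers.\<close>

definition lat_cong :: "nat \<Rightarrow> ('n::finite) cvec set \<Rightarrow> 'n cvec \<Rightarrow> 'n cvec \<Rightarrow> bool" where
  "lat_cong N L x y \<longleftrightarrow> (\<exists>l\<in>L. x - y = of_nat N *s l)"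

lemma lat_cong_iff:
  assumes "N > 0"
  shows "lat_cong N L x y \<longleftrightarrow> (1 / of_nat N) *s (x - y) \<in> L"
proof
  assume "lat_cong N L x y"
  then obtain l where "l \<in> L" "x - y = of_nat N *s l" by (auto simp: lat_cong_def)
  then show "(1 / of_nat N) *s (x - y) \<in> L" using assms by (simp del: vector_ssub_ldistrib)
next
  assume "(1 / of_nat N) *s (x - y) \<in> L"
  then show "lat_cong N L x y" unfolding lat_cong_def
    by (rule rev_bexI) (use assms in \<open>simp del: vector_ssub_ldistrib\<close>)
qed

context symp begin

lemma lat_cong_refl: "lat_cong N L x x"
  using L_zero by (auto simp: lat_cong_def intro!: bexI[of _ 0])

lemma lat_cong_sym: "lat_cong N L x y \<Longrightarrow> lat_cong N L y x"
  unfolding lat_cong_def using L_minus by (metis minus_diff_eq vector_smult_rneg)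

lemma lat_cong_add: "lat_cong N L x y \<Longrightarrow> lat_cong N L x' y' \<Longrightarrow> lat_cong N L (x + x') (y + y')"
  unfolding lat_cong_def using L_add by (metis add_diff_add vector_add_ldistrib)

lemma lat_cong_trans: "lat_cong N L x y \<Longrightarrow> lat_cong N L y z \<Longrightarrow> lat_cong N L x z"
  using lat_cong_add[of N x y y z] by (simp add: lat_cong_def)

lemma lat_cong_smult: "k \<in> \<int> \<Longrightarrow> lat_cong N L x y \<Longrightarrow> lat_cong N L (k *\<^sub>R x) (k *\<^sub>R y)"
  unfolding lat_cong_def using L_int 
  by (metis scaleR_eq_smult vector_ssub_ldistrib vec.scale_left_commute)

lemma lat_cong_sum: "(\<And>i. i \<in> S \<Longrightarrow> lat_cong N L (f i) (g i)) \<Longrightarrow> lat_cong N L (\<Sum>i\<in>S. f i) (\<Sum>i\<in>S. g i)"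
  by (induction S rule: infinite_finite_induct) (auto simp: lat_cong_refl lat_cong_add)

lemma lat_cong_rcomb_iff: "lat_cong N L (rcomb a b u v) (rcomb a' b' u v) \<longleftrightarrow>
    (\<forall>i. \<exists>k l. a i - a' i = real N * of_int k \<and> b i - b' i = real N * of_int l)"
proof
  assume "lat_cong N L (rcomb a b u v) (rcomb a' b' u v)"
  then obtain l where l: "l \<in> L" "rcomb (\<lambda>i. a i - a' i) (\<lambda>i. b i - b' i) u v = real N *\<^sub>R l"
    unfolding lat_cong_def rcomb_diff by (auto simp: scaleR_eq_smult)
  have "real N *\<^sub>R l = rcomb (\<lambda>i. real N * Im (H l (v i))) (\<lambda>i. real N * - Im (H l (u i))) u v"
    by (subst J_basis_expand[OF J, of l]) (simp only: rcomb_scaleR)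
  from J_basis_inj[OF J l(2)[unfolded this]]
  have "a i - a' i = real N * Im (H l (v i))" "b i - b' i = real N * - Im (H l (u i))" for i
    by (metis, metis)
  moreover have "Im (H l (v i)) \<in> \<int>" "- Im (H l (u i)) \<in> \<int>" for i using l(1) by (auto simp: L_eq)
  ultimately show "\<forall>i. \<exists>k l. a i - a' i = real N * of_int k \<and> b i - b' i = real N * of_int l"
    by (metis Ints_cases)
next
  assume "\<forall>i. \<exists>k l. a i - a' i = real N * of_int k \<and> b i - b' i = real N * of_int l"
  then obtain k l where "\<And>i. a i - a' i = real N * of_int (k i)" "\<And>i. b i - b' i = real N * of_int (l i)" by metis
  then have "rcomb a b u v - rcomb a' b' u v = of_nat N *s rcomb (\<lambda>i. of_int (k i)) (\<lambda>i. of_int (l i)) u v"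
    unfolding rcomb_diff using rcomb_scaleR[of "real N", symmetric] by (simp add: scaleR_eq_smult)
  then show "lat_cong N L (rcomb a b u v) (rcomb a' b' u v)"
    unfolding lat_cong_def using rcomb_L by (metis Ints_of_int)
qed

lemma int_comb_L: "int_comb A B u v i \<in> L"
  unfolding int_comb_def by (rule rcomb_L) auto

lemma L_int_comb:
  assumes "\<And>i. w i \<in> L"
  shows "\<exists>A B. \<forall>i. w i = int_comb A B u v i"
proof -
  have "\<exists>a b. w i = rcomb (\<lambda>j. of_int (a j)) (\<lambda>j. of_int (b j)) u v" for i
    using assms[of i] sb unfolding symplectic_basis_def rcomb_def by blast
  then obtain a b where ab: "\<And>i. w i = rcomb (\<lambda>j. of_int (a i j)) (\<lambda>j. of_int (b i j)) u v" by metis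
  show ?thesis
    by (rule exI[of _ "\<chi> i j. a i j"], rule exI[of _ "\<chi> i j. b i j"]) (simp add: int_comb_def ab)
qed

lemma int_comb_inj: 
  assumes "\<And>i. int_comb A B u v i = int_comb A' B' u v i" shows "A = A'" "B = B'"
  using J_basis_inj[OF J, OF assms[unfolded int_comb_def]]
  by (auto simp: vec_eq_iff fun_eq_iff)

lemma lat_cong_int_comb_u: "lat_cong N L (int_comb A B u v i) (u i) \<longleftrightarrow>
    (\<forall>j. int N dvd (A $ i $ j - mat 1 $ i $ j) \<and> int N dvd B $ i $ j)"
  and lat_cong_int_comb_v: "lat_cong N L (int_comb A B u v i) (v i) \<longleftrightarrow>
    (\<forall>j. int N dvd A $ i $ j \<and> int N dvd (B $ i $ j - mat 1 $ i $ j))"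
proof -
  have e: "real_of_int x = real N * real_of_int k \<longleftrightarrow> x = int N * k" for x k
    by (metis of_int_mult of_int_of_nat_eq of_int_eq_iff)
  have u: "u i = rcomb (\<lambda>j. of_int (mat 1 $ i $ j)) (\<lambda>j. of_int 0) u v" 
    and v: "v i = rcomb (\<lambda>j. of_int 0) (\<lambda>j. of_int (mat 1 $ i $ j)) u v"
    using rcomb_left[of i u v] rcomb_right[of i u v]
    by (simp_all add: mat_def eq_commute[of i] if_distrib[of real_of_int] cong: if_cong)
  show "lat_cong N L (int_comb A B u v i) (u i) \<longleftrightarrow>
    (\<forall>j. int N dvd (A $ i $ j - mat 1 $ i $ j) \<and> int N dvd B $ i $ j)"
    by (subst u) (simp only: int_comb_def lat_cong_rcomb_iff of_int_diff[symmetric] e dvd_def ex_simps diff_0_right)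
  show "lat_cong N L (int_comb A B u v i) (v i) \<longleftrightarrow>
    (\<forall>j. int N dvd A $ i $ j \<and> int N dvd (B $ i $ j - mat 1 $ i $ j))"
    by (subst v) (simp only: int_comb_def lat_cong_rcomb_iff of_int_diff[symmetric] e dvd_def ex_simps diff_0_right)
qed

text \<open>The dictionary for the congruence subgroup: the symplectic condition says that the new
  family is again of type \<open>J\<close>, and congruence to the identity says that it induces the
  same level structure.\<close>

lemma Gamma_iff:
  "(A, B, C, D) \<in> Gamma N \<longleftrightarrow> J_basis (int_comb A B u v) (int_comb C D u v) \<and>
    (\<forall>i. lat_cong N L (int_comb A B u v i) (u i) \<and> lat_cong N L (int_comb C D u v i) (v i))"
  unfolding Gamma_def J_basis_int_comb_iff[OF J] lat_cong_int_comb_u lat_cong_int_comb_v by auto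

end

lemma lat_cong_image:
  assumes "clinear f" "lat_cong N L x y" "f ` L = L'"
  shows "lat_cong N L' (f x) (f y)"
  using assms unfolding lat_cong_def by (metis clinear_diff clinear_smult imageI)

section \<open>Level isomorphisms and the action of the congruence group\<close>

text \<open>An isomorphism from \<open>A_Z\<close> to \<open>A_Z'\<close> as polarized varieties
  with level structure, with no real structure involved. Compatibility with real structures is
  derived later from uniqueness.\<close>

definition level_iso :: "nat \<Rightarrow> ('n::finite) cmat \<Rightarrow> 'n cmat \<Rightarrow> ('n cvec \<Rightarrow> 'n cvec) \<Rightarrow> bool" where
  "level_iso N Z Z' f \<longleftrightarrow> clinear f \<and> bij f \<and> f ` L_Z Z = L_Z Z' \<and>
    (\<forall>x y. H_Z Z' (f x) (f y) = H_Z Z x y) \<and>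
    (\<forall>i. lat_cong N (L_Z Z') (f (column i Z)) (column i Z') \<and> lat_cong N (L_Z Z') (f (unitv i)) (unitv i))"

section \<open>Groupoid laws and uniqueness of level isomorphisms\<close>

lemma level_iso_comp:
  assumes "level_iso N Z Z' f" "level_iso N Z' Z'' g" "Z'' \<in> siegel"
  shows "level_iso N Z Z'' (g \<circ> f)"
proof -
  interpret symp "H_Z Z''" "L_Z Z''" "\<lambda>i. column i Z''" unitv using siegel_symp[OF assms(3)] .
  have "lat_cong N (L_Z Z'') (g x) (g y)" if "lat_cong N (L_Z Z') x y" for x y
    using lat_cong_image[of g, OF _ that] assms(2) by (auto simp: level_iso_def)
  then have 1: "lat_cong N (L_Z Z'') (g (f (column i Z))) (g (column i Z'))"
     "lat_cong N (L_Z Z'') (g (f (unitv i))) (g (unitv i))" for i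
    using assms(1) by (simp_all add: level_iso_def)
  have 2: "lat_cong N (L_Z Z'') (g (column i Z')) (column i Z'')" "lat_cong N (L_Z Z'') (g (unitv i)) (unitv i)" for i
    using assms(2) by (simp_all add: level_iso_def)
  have "lat_cong N (L_Z Z'') ((g \<circ> f) (column i Z)) (column i Z'')"
     "lat_cong N (L_Z Z'') ((g \<circ> f) (unitv i)) (unitv i)" for i
    using lat_cong_trans[OF 1(1) 2(1)] lat_cong_trans[OF 1(2) 2(2)] by simp_all
  moreover have "(g \<circ> f) ` L_Z Z = L_Z Z''"
    unfolding image_comp[symmetric] using assms(1,2) by (simp add: level_iso_def)
  ultimately show ?thesis
    using assms(1,2) by (simp add: level_iso_def clinear_comp bij_comp)
qed

lemma level_iso_inv:
  assumes "level_iso N Z Z' f" "Z \<in> siegel"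
  shows "level_iso N Z' Z (inv f)"
proof -
  interpret symp "H_Z Z" "L_Z Z" "\<lambda>i. column i Z" unitv using siegel_symp[OF assms(2)] .
  have f: "clinear f" "bij f" and L: "f ` L_Z Z = L_Z Z'" using assms(1) by (auto simp: level_iso_def)
  have i: "inv f (f x) = x" "f (inv f x) = x" for x
    using f(2) by (simp_all add: bij_is_inj bij_is_surj surj_f_inv_f)
  have c: "clinear (inv f)" using clinear_inv[OF f] .
  have L': "inv f ` L_Z Z' = L_Z Z" unfolding L[symmetric] by (simp add: image_image i)
  have "lat_cong N (L_Z Z) (inv f y) x" if "lat_cong N (L_Z Z') (f x) y" for x y
    using lat_cong_image[OF c that L'] by (simp add: i lat_cong_sym)
  moreover have "H_Z Z (inv f x) (inv f y) = H_Z Z' x y" for x y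
  proof -
    have "H_Z Z' (f (inv f x)) (f (inv f y)) = H_Z Z (inv f x) (inv f y)"
      using assms(1) unfolding level_iso_def by blast
    then show ?thesis by (simp add: i)
  qed
  ultimately show ?thesis
    using assms(1) c L' f(2) by (simp add: level_iso_def bij_imp_bij_inv)
qed

lemma level_iso_id: "Z \<in> siegel \<Longrightarrow> level_iso N Z Z id"
  by (simp add: level_iso_def clinear_def symp.lat_cong_refl[OF siegel_symp])

lemma level_iso_rigid:
  assumes "level_iso N Z Z f" "Z \<in> siegel" "N \<ge> 4"
  shows "f = id"
proof
  fix x
  interpret symp "H_Z Z" "L_Z Z" "\<lambda>i. column i Z" unitv using siegel_symp[OF assms(2)] .
  have f: "clinear f" using assms(1) by (simp add: level_iso_def)
  have "f x = x"
  proof (rule rigidity[OF f])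
    show "H_Z Z (f x) (f y) = H_Z Z x y" for x y using assms(1) by (simp add: level_iso_def)
    show "\<exists>l\<in>L_Z Z. f x - x = of_nat N *s l" if xL: "x \<in> L_Z Z" for x
    proof -
      \<comment> \<open>The level condition concerns only basis vectors; it passes to every integral
        combination by linearity.\<close>
      have "lat_cong N (L_Z Z) (f x) x"
      proof -
        obtain a b where x: "x = rcomb (\<lambda>i. of_int (a i)) (\<lambda>i. of_int (b i)) (\<lambda>i. column i Z) unitv"
          using xL unfolding L_Z_eq by blast
        show ?thesis
          unfolding x clinear_rcomb[OF f] unfolding rcomb_def
          using assms(1) by (intro lat_cong_sum lat_cong_add lat_cong_smult) (auto simp: level_iso_def)
      qed
      then show ?thesis by (simp add: lat_cong_def)
    qed
  qed (fact assms(3))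
  then show "f x = id x" by simp
qed

lemma level_iso_unique:
  assumes "level_iso N Z Z' f" "level_iso N Z Z' g" "Z \<in> siegel" "N \<ge> 4"
  shows "f = g"
proof -
  have "level_iso N Z Z (inv g \<circ> f)"
    using level_iso_comp[OF assms(1) level_iso_inv[OF assms(2,3)] assms(3)] .
  from level_iso_rigid[OF this assms(3,4)] have "inv g (f x) = x" for x by (simp add: fun_eq_iff)
  moreover have "g (inv g (f x)) = f x" for x
    using assms(2) by (simp add: level_iso_def bij_is_surj surj_f_inv_f)
  ultimately show ?thesis by (simp add: fun_eq_iff)
qed

section \<open>The action as a change of symplectic basis\<close>

lemma int_comb_eq_row:
  assumes "transpose Z = Z"
  shows "int_comb C D (\<lambda>j. column j Z) unitv i = row i (cmat_of_int C ** Z + cmat_of_int D)"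
proof -
  have Z: "Z $ i $ j = Z $ j $ i" for i j using assms unfolding transpose_def vec_eq_iff by simp
  have "row i (cmat_of_int C ** Z + cmat_of_int D) $ k = (\<Sum>j\<in>UNIV. of_int (C $ i $ j) * Z $ k $ j) + of_int (D $ i $ k)" for k
    by (simp add: row_def cmat_of_int_def matrix_matrix_mult_def Z[of _ k])
  moreover have "int_comb C D (\<lambda>j. column j Z) unitv i $ k = (\<Sum>j\<in>UNIV. of_int (C $ i $ j) * Z $ k $ j) + of_int (D $ i $ k)" for k
    by (simp add: int_comb_def rcomb_def sum.distrib column_def axis_def
      scaleR_conv_of_real[where 'a=complex] if_distrib[of "\<lambda>x. _ * x"] cong: if_cong)
  ultimately show ?thesis by (simp add: vec_eq_iff)
qed

text \<open>Since \<open>Z\<close> is symmetric, the new basis vectors are the rows of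
  \<open>Q = AZ + B\<close> and \<open>P = CZ + D\<close>. As \<open>inv f\<close> sends unit
  vectors to the rows of \<open>P\<close>, it is multiplication by \<open>P^t\<close>; applying it
  to the columns of the symmetric \<open>Z'\<close> gives \<open>Z' P = Q\<close>.\<close>

lemma act_eqI:
  assumes Z: "Z \<in> siegel" "Z' \<in> siegel" and f: "clinear f" "bij f"
    and u: "\<And>i. f (int_comb A B (\<lambda>j. column j Z) unitv i) = column i Z'"
    and v: "\<And>i. f (int_comb C D (\<lambda>j. column j Z) unitv i) = unitv i"
  shows "act (A, B, C, D) Z = Z'" "inv f x = transpose (cmat_of_int C ** Z + cmat_of_int D) *v x"
proof -
  define P Q where "P = cmat_of_int C ** Z + cmat_of_int D" and "Q = cmat_of_int A ** Z + cmat_of_int B"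
  have i: "inv f (f x) = x" "f (inv f x) = x" for x
    using f(2) by (simp_all add: bij_is_inj bij_is_surj surj_f_inv_f)
  have g: "clinear (inv f)" using clinear_inv[OF f] .
  have gu: "inv f (column i Z') = row i Q" and gv: "inv f (unitv i) = row i P" for i
    using i(1)[of "row i Q"] i(1)[of "row i P"] u[of i] v[of i]
    unfolding int_comb_eq_row[OF siegel_sym[OF Z(1)]] P_def[symmetric] Q_def[symmetric] by simp_all
  have M: "matrix (inv f) *v x = inv f x" for x using clinear_matrix[OF g] .
  have "column i (matrix (inv f)) = column i (transpose P)" for i
    using M[of "unitv i"] gv[of i] by (simp add: matrix_vector_mult_unitv column_transpose)
  then have Mt: "matrix (inv f) = transpose P"
    by (simp add: vec_eq_iff column_def)
  then have gP: "inv f x = transpose P *v x" for x using M by simp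
  then show "inv f x = transpose (cmat_of_int C ** Z + cmat_of_int D) *v x" by (simp add: P_def)
  have "column i (transpose P ** Z') = column i (transpose Q)" for i
  proof -
    have "column i (transpose P ** Z') = transpose P *v column i Z'"
      by (simp only: matrix_vector_mult_unitv[symmetric] matrix_vector_mul_assoc)
    then show ?thesis using gu[of i] by (simp only: gP column_transpose)
  qed
  then have "transpose P ** Z' = transpose Q" by (simp add: vec_eq_iff column_def)
  then have "transpose (transpose P ** Z') = Q" by simp
  then have ZP: "Z' ** P = Q" by (simp add: matrix_transpose_mul siegel_sym[OF Z(2)])
  have "invertible (transpose P)"
    unfolding invertible_left_inverse matrix_left_invertible_ker gP[symmetric]
  proof (intro allI impI)
    fix x assume "inv f x = 0" then show "x = 0" using i(2)[of x] clinear_0[OF f(1)] by simp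
  qed
  then obtain R where "transpose P ** R = mat 1" "R ** transpose P = mat 1" by (auto simp: invertible_def)
  then have "transpose (transpose P ** R) = mat 1" "transpose (R ** transpose P) = mat 1" by (simp_all add: transpose_mat)
  then have inv: "invertible P" unfolding matrix_transpose_mul transpose_transpose invertible_def by blast
  have "act (A, B, C, D) Z = Z' ** P ** matrix_inv P"
    by (simp add: act_def ZP P_def[symmetric] Q_def[symmetric])
  also have "\<dots> = Z'" by (simp add: matrix_mul_assoc[symmetric] matrix_inv_works[OF inv])
  finally show "act (A, B, C, D) Z = Z'" .
qed

lemma level_iso_of_Gamma:
  assumes Z: "Z \<in> siegel" and g: "(A, B, C, D) \<in> Gamma N"
  obtains f where "act (A, B, C, D) Z \<in> siegel" "level_iso N Z (act (A, B, C, D) Z) f"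
    "\<And>x. inv f x = transpose (cmat_of_int C ** Z + cmat_of_int D) *v x"
    "\<And>i. f (int_comb A B (\<lambda>j. column j Z) unitv i) = column i (act (A, B, C, D) Z)"
    "\<And>i. f (int_comb C D (\<lambda>j. column j Z) unitv i) = unitv i"
proof -
  interpret symp "H_Z Z" "L_Z Z" "\<lambda>i. column i Z" unitv using siegel_symp[OF Z] .
  let ?u = "int_comb A B (\<lambda>j. column j Z) unitv" and ?v = "int_comb C D (\<lambda>j. column j Z) unitv"
  have J': "J_basis ?u ?v" and c: "\<And>i. lat_cong N (L_Z Z) (?u i) (column i Z)" "\<And>i. lat_cong N (L_Z Z) (?v i) (unitv i)"
    using g Gamma_iff by blast+
  have "symplectic_basis (H_Z Z) (L_Z Z) ?u ?v"
    using symplectic_basis_change[OF J' int_comb_L int_comb_L] .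
  then interpret s': symp "H_Z Z" "L_Z Z" ?u ?v by unfold_locales
  obtain Z' f where P: "Z' \<in> siegel" "clinear f" "bij f" "\<And>i. f (?u i) = column i Z'" "\<And>i. f (?v i) = unitv i"
    "f ` L_Z Z = L_Z Z'" "\<And>x y. H_Z Z' (f x) (f y) = H_Z Z x y" by (rule s'.period) blast
  note a = act_eqI[OF Z P(1-5)]
  \<comment> \<open>\<open>f\<close> carries the new basis exactly to the standard one of
    \<open>Z'\<close>, so the congruence between old and new basis becomes the level
    condition.\<close>
  have "level_iso N Z Z' f"
    unfolding level_iso_def
    using P lat_cong_image[OF P(2) lat_cong_sym[OF c(1)] P(6)] lat_cong_image[OF P(2) lat_cong_sym[OF c(2)] P(6)]
    by simp
  then show thesis using P(1,4,5) a(2) by (intro that[of f, unfolded a(1)])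
qed

text \<open>Pulling the standard basis of \<open>Z'\<close> back along \<open>f\<close> gives a
  second symplectic basis of \<open>L_Z Z\<close>. Its integral coordinates are the blocks of the
  required matrix.\<close>

lemma Gamma_of_level_iso:
  assumes Z: "Z \<in> siegel" "Z' \<in> siegel" and f: "level_iso N Z Z' f"
  obtains g where "g \<in> Gamma N" "act g Z = Z'"
proof -
  interpret symp "H_Z Z" "L_Z Z" "\<lambda>i. column i Z" unitv using siegel_symp[OF Z(1)] .
  interpret s': symp "H_Z Z'" "L_Z Z'" "\<lambda>i. column i Z'" unitv using siegel_symp[OF Z(2)] .
  have ff: "clinear f" "bij f" using f by (auto simp: level_iso_def)
  have i: "f (inv f x) = x" for x using ff(2) by (simp add: bij_is_surj surj_f_inv_f)
  have g: "level_iso N Z' Z (inv f)" using level_iso_inv[OF f Z(1)] .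
  then have gL: "inv f ` L_Z Z' = L_Z Z" and gH: "\<And>x y. H_Z Z (inv f x) (inv f y) = H_Z Z' x y"
    by (auto simp: level_iso_def)
  have L: "inv f (column i Z') \<in> L_Z Z" "inv f (unitv i) \<in> L_Z Z" for i
    using imageI[OF s'.u_L, of "inv f" i] imageI[OF s'.v_L, of "inv f" i] unfolding gL by auto
  obtain A B where AB: "\<And>i. inv f (column i Z') = int_comb A B (\<lambda>j. column j Z) unitv i"
    using L_int_comb[of "\<lambda>i. inv f (column i Z')", OF L(1)] by blast
  obtain C D where CD: "\<And>i. inv f (unitv i) = int_comb C D (\<lambda>j. column j Z) unitv i"
    using L_int_comb[of "\<lambda>i. inv f (unitv i)", OF L(2)] by blast
  have "(A, B, C, D) \<in> Gamma N"
    unfolding Gamma_iff unfolding J_basis_def AB[symmetric] CD[symmetric] gH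
    using s'.J g by (simp add: s'.J_basis_def level_iso_def)
  moreover have "act (A, B, C, D) Z = Z'"
    by (rule act_eqI(1)[OF Z ff]) (simp_all add: i flip: AB CD)
  ultimately show thesis using that by blast
qed

lemma orbit_eq: "Z \<in> siegel \<Longrightarrow> orbit N Z = {Z' \<in> siegel. \<exists>f. level_iso N Z Z' f}"
proof (intro equalityI subsetI)
  fix Z' assume Z: "Z \<in> siegel" and "Z' \<in> orbit N Z"
  then obtain A B C D where g: "(A, B, C, D) \<in> Gamma N" "Z' = act (A, B, C, D) Z" unfolding orbit_def by auto
  show "Z' \<in> {Z' \<in> siegel. \<exists>f. level_iso N Z Z' f}"
    unfolding g(2) by (rule level_iso_of_Gamma[OF Z g(1)]) auto
next
  fix Z' assume "Z \<in> siegel" and "Z' \<in> {Z' \<in> siegel. \<exists>f. level_iso N Z Z' f}"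
  then obtain f where f: "Z \<in> siegel" "Z' \<in> siegel" "level_iso N Z Z' f" by blast
  show "Z' \<in> orbit N Z" unfolding orbit_def by (rule Gamma_of_level_iso[OF f]) auto
qed

text \<open>Orbits are compared through composition and inversion of level isomorphisms, which
  replace the group law of \<open>Gamma N\<close>.\<close>

lemma orbit_eq_iff:
  assumes "Z \<in> siegel" "Z' \<in> siegel"
  shows "orbit N Z = orbit N Z' \<longleftrightarrow> (\<exists>f. level_iso N Z Z' f)"
proof
  assume "orbit N Z = orbit N Z'"
  then have "Z' \<in> orbit N Z" using level_iso_id[OF assms(2), of N] assms(2) unfolding orbit_eq[OF assms(2)] by blast
  then show "\<exists>f. level_iso N Z Z' f" unfolding orbit_eq[OF assms(1)] by blast
next
  assume "\<exists>f. level_iso N Z Z' f"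
  then obtain f where f: "level_iso N Z Z' f" ..
  have "(\<exists>g. level_iso N Z W g) \<longleftrightarrow> (\<exists>g. level_iso N Z' W g)" if "W \<in> siegel" for W
    using level_iso_comp[OF f _ that] level_iso_comp[OF level_iso_inv[OF f assms(1)] _ that] by metis
  then show "orbit N Z = orbit N Z'" unfolding orbit_eq[OF assms(1)] orbit_eq[OF assms(2)] by auto
qed

text \<open>Two matrices with the same image of \<open>Z\<close> yield level isomorphisms with the
  same source and target, equal by rigidity. Both new bases are then preimages of the same standard
  basis, so their coordinates agree.\<close>

lemma Gamma_act_unique:
  assumes Z: "Z \<in> siegel" and N: "N \<ge> 4" and g: "g \<in> Gamma N" "g' \<in> Gamma N" "act g Z = act g' Z"
  shows "g = g'"
proof -
  interpret symp "H_Z Z" "L_Z Z" "\<lambda>i. column i Z" unitv using siegel_symp[OF Z] .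
  obtain A B C D where gg1: "g = (A, B, C, D)" by (cases g)
  obtain A' B' C' D' where gg2: "g' = (A', B', C', D')" by (cases g')
  note gg = gg1 gg2
  obtain f where f: "level_iso N Z (act g Z) f" 
    "\<And>i. f (int_comb A B (\<lambda>j. column j Z) unitv i) = column i (act g Z)"
    "\<And>i. f (int_comb C D (\<lambda>j. column j Z) unitv i) = unitv i"
    by (rule level_iso_of_Gamma[OF Z g(1)[unfolded gg], folded gg]) blast
  obtain f' where f': "level_iso N Z (act g' Z) f'" 
    "\<And>i. f' (int_comb A' B' (\<lambda>j. column j Z) unitv i) = column i (act g' Z)"
    "\<And>i. f' (int_comb C' D' (\<lambda>j. column j Z) unitv i) = unitv i"
    by (rule level_iso_of_Gamma[OF Z g(2)[unfolded gg], folded gg]) blast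
  have ff: "f = f'" using level_iso_unique[OF f(1) f'(1)[folded g(3)] Z N] .
  have inj: "inj f" using f(1) by (simp add: level_iso_def bij_is_inj)
  have "int_comb A B (\<lambda>j. column j Z) unitv i = int_comb A' B' (\<lambda>j. column j Z) unitv i"
    "int_comb C D (\<lambda>j. column j Z) unitv i = int_comb C' D' (\<lambda>j. column j Z) unitv i" for i
    by (rule injD[OF inj], simp only: f f'[folded ff] g(3))+
  then show ?thesis unfolding gg using int_comb_inj[of A B A' B'] int_comb_inj[of C D C' D'] by simp
qed

section \<open>Real structures\<close>

lemma cnjV_simps: "cnjV (x + y) = cnjV x + cnjV y" "cnjV (x - y) = cnjV x - cnjV y" "cnjV (- x) = - cnjV x"
  "cnjV (c *s x) = cnj c *s cnjV x" "cnjV (cnjV x) = x" "cnjV (r *\<^sub>R x) = r *\<^sub>R cnjV x"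
  "cnjV (unitv i) = unitv i" "cnjV 0 = 0"
  by (auto simp: cnjV_def vec_eq_iff axis_def)

text \<open>Conjugation fixes the \<open>v\<close> half of the standard basis and reverses the
  \<open>u\<close> half when passing from \<open>Z\<close> to \<open>- cnjM Z\<close>. This is the
  source of the signs in the compatibility of \<open>kap\<close> with the level structure.\<close>

lemma cnjV_column: "cnjV (column i Z) = - column i (- cnjM Z)"
  by (simp add: cnjV_def vec_eq_iff column_def cnjM_def)

lemma bij_cnjV: "bij cnjV"
  by (rule bij_betw_byWitness[of _ cnjV]) (auto simp: cnjV_simps)

lemma cnjV_sum: "cnjV (\<Sum>i\<in>S. f i) = (\<Sum>i\<in>S. cnjV (f i))"
  by (induction S rule: infinite_finite_induct) (auto simp: cnjV_simps)

lemma neg_cnjM_invol: "- cnjM (- cnjM Z) = Z"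
  by (simp add: cnjM_def vec_eq_iff)

lemma ImM_neg_cnjM: "ImM (- cnjM Z) = ImM Z"
  by (simp add: cnjM_def vec_eq_iff ImM_def)

lemma siegel_neg_cnjM: "Z \<in> siegel \<Longrightarrow> - cnjM Z \<in> siegel"
  unfolding siegel_def mem_Collect_eq ImM_neg_cnjM by (auto simp: transpose_def cnjM_def vec_eq_iff)

lemma H_Z_neg_cnjM: "H_Z (- cnjM Z) (cnjV x) (cnjV y) = cnj (H_Z Z x y)"
  by (simp add: H_Z_def ImM_neg_cnjM cnjV_def)

lemma cnjV_L_Z_subset: "cnjV ` L_Z Z \<subseteq> L_Z (- cnjM Z)"
proof
  fix w assume "w \<in> cnjV ` L_Z Z"
  then obtain a b where w: "w = cnjV (rcomb (\<lambda>i. of_int (a i)) (\<lambda>i. of_int (b i)) (\<lambda>i. column i Z) unitv)"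
    unfolding L_Z_eq by blast
  then have "w = rcomb (\<lambda>i. of_int (- a i)) (\<lambda>i. of_int (b i)) (\<lambda>i. column i (- cnjM Z)) unitv"
    by (simp add: rcomb_def cnjV_sum cnjV_simps cnjV_column)
  then show "w \<in> L_Z (- cnjM Z)"
    unfolding L_Z_eq by (intro CollectI exI[of _ "\<lambda>i. - a i"] exI[of _ b] conjI TrueI)
qed

lemma cnjV_L_Z: "cnjV ` L_Z Z = L_Z (- cnjM Z)"
proof
  have "cnjV ` cnjV ` L_Z (- cnjM Z) \<subseteq> cnjV ` L_Z Z"
    using cnjV_L_Z_subset[of "- cnjM Z"] unfolding neg_cnjM_invol by (rule image_mono)
  then show "L_Z (- cnjM Z) \<subseteq> cnjV ` L_Z Z" by (simp add: image_image cnjV_simps)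
qed (rule cnjV_L_Z_subset)

lemma lat_cong_cnjV: "lat_cong N (L_Z Z) x y \<Longrightarrow> lat_cong N (L_Z (- cnjM Z)) (cnjV x) (cnjV y)"
  unfolding lat_cong_def cnjV_L_Z[symmetric]
  by (force simp: cnjV_simps(2)[symmetric] cnjV_simps(4))

lemma lat_cong_minus: "Z \<in> siegel \<Longrightarrow> lat_cong N (L_Z Z) x y \<Longrightarrow> lat_cong N (L_Z Z) (- x) (- y)"
  using symp.lat_cong_smult[OF siegel_symp, of Z "-1" N x y] by simp

lemma level_iso_neg_cnjM:
  assumes "level_iso N Z Z' f" "Z' \<in> siegel"
  shows "level_iso N (- cnjM Z) (- cnjM Z') (\<lambda>x. cnjV (f (cnjV x)))"
proof -
  have f: "clinear f" "bij f" "f ` L_Z Z = L_Z Z'" "\<And>x y. H_Z Z' (f x) (f y) = H_Z Z x y"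
    "\<And>i. lat_cong N (L_Z Z') (f (column i Z)) (column i Z')" "\<And>i. lat_cong N (L_Z Z') (f (unitv i)) (unitv i)"
    using assms(1) by (auto simp: level_iso_def)
  have "clinear (\<lambda>x. cnjV (f (cnjV x)))"
    using f(1) by (simp add: clinear_def cnjV_simps)
  moreover have "bij (\<lambda>x. cnjV (f (cnjV x)))"
    using bij_comp[OF bij_comp[OF bij_cnjV f(2)] bij_cnjV] by (simp add: comp_def)
  moreover have "(\<lambda>x. cnjV (f (cnjV x))) ` L_Z (- cnjM Z) = L_Z (- cnjM Z')"
  proof -
    have "(\<lambda>x. cnjV (f (cnjV x))) ` L_Z (- cnjM Z) = cnjV ` f ` cnjV ` L_Z (- cnjM Z)" by (simp add: image_image)
    then show ?thesis by (simp only: cnjV_L_Z neg_cnjM_invol f(3))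
  qed
  moreover have "H_Z (- cnjM Z') (cnjV (f (cnjV x))) (cnjV (f (cnjV y))) = H_Z (- cnjM Z) x y" for x y
    using H_Z_neg_cnjM[of Z "cnjV x" "cnjV y"] by (simp add: H_Z_neg_cnjM f(4) cnjV_simps)
  moreover have "lat_cong N (L_Z (- cnjM Z')) (cnjV (f (cnjV (column i (- cnjM Z))))) (column i (- cnjM Z'))" for i
    \<comment> \<open>Both columns acquire a minus sign under conjugation, so the congruence is
      negated first.\<close>
    using lat_cong_cnjV[OF lat_cong_minus[OF assms(2) f(5)[of i]]]
    by (simp add: cnjV_column neg_cnjM_invol clinear_minus[OF f(1)] cnjV_simps)
  moreover have "lat_cong N (L_Z (- cnjM Z')) (cnjV (f (cnjV (unitv i)))) (unitv i)" for i
    using lat_cong_cnjV[OF f(6)[of i]] by (simp add: cnjV_simps)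
  ultimately show ?thesis by (simp add: level_iso_def)
qed

text \<open>Antiholomorphic level automorphisms are automatically involutions: their square is a
  level automorphism, hence trivial by rigidity.\<close>

lemma level_iso_neg_cnjM_invol:
  assumes "level_iso N Z (- cnjM Z) f" "Z \<in> siegel" "N \<ge> 4"
  shows "cnjV (f (cnjV (f x))) = x"
proof -
  have "level_iso N (- cnjM Z) Z (\<lambda>x. cnjV (f (cnjV x)))"
    using level_iso_neg_cnjM[OF assms(1) siegel_neg_cnjM[OF assms(2)]] by (simp add: neg_cnjM_invol)
  from level_iso_rigid[OF level_iso_comp[OF assms(1) this assms(2)] assms(2,3)]
  show ?thesis by (simp add: fun_eq_iff)
qed

section \<open>The matrix \<open>gamma_of\<close> and the real structure
  \<open>kappa_Z\<close>\<close>

lemma Sset_iff: "Z \<in> Sset N \<longleftrightarrow> Z \<in> siegel \<and> (\<exists>f. level_iso N Z (- cnjM Z) f)"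
proof -
  have "(\<exists>\<gamma>\<in>Gamma N. act \<gamma> Z = - cnjM Z) \<longleftrightarrow> - cnjM Z \<in> orbit N Z"
    unfolding orbit_def mem_Collect_eq by metis
  then show ?thesis unfolding Sset_def using orbit_eq[of Z N] siegel_neg_cnjM[of Z] by auto
qed

lemma Sset_ex1:
  assumes "Z \<in> Sset N" "N \<ge> 4"
  shows "\<exists>!\<gamma>. \<gamma> \<in> Gamma N \<and> act \<gamma> Z = - cnjM Z"
proof -
  obtain g where g: "Z \<in> siegel" "g \<in> Gamma N" "act g Z = - cnjM Z" using assms(1) by (auto simp: Sset_def)
  show ?thesis
  proof (rule ex1I[of _ g])
    show "h = g" if "h \<in> Gamma N \<and> act h Z = - cnjM Z" for h
      using that g(3) by (intro Gamma_act_unique[OF g(1) assms(2) _ g(2)]) auto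
  qed (use g in blast)
qed

text \<open>The transpose of \<open>CZ + D\<close> represents \<open>inv f\<close>, so
  \<open>kappa_Z\<close> is \<open>inv f\<close> after conjugation, the inverse of conjugation after
  \<open>f\<close>. The latter is an involution, hence equal to its inverse.\<close>

lemma kappa_Z_eq:
  assumes f: "level_iso N Z (- cnjM Z) f" and Z: "Z \<in> siegel" and N: "N \<ge> 4"
  shows "kappa_Z N Z x = cnjV (f x)"
proof -
  have S: "Z \<in> Sset N" using assms Sset_iff by blast
  have g: "gamma_of N Z \<in> Gamma N" "act (gamma_of N Z) Z = - cnjM Z"
    using theI'[OF Sset_ex1[OF S N]] by (simp_all add: gamma_of_def)
  obtain A B C D where gg: "gamma_of N Z = (A, B, C, D)" by (cases "gamma_of N Z")
  obtain f' where f': "level_iso N Z (- cnjM Z) f'"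
    "\<And>x. inv f' x = transpose (cmat_of_int C ** Z + cmat_of_int D) *v x"
    by (rule level_iso_of_Gamma[OF Z g(1)[unfolded gg]]) (use g(2) gg in auto)
  have "f' = f" using level_iso_unique[OF f'(1) f Z N] .
  then have "kappa_Z N Z x = inv f (cnjV x)" using f'(2) by (simp add: kappa_Z_def gg)
  moreover have "f (cnjV (f x)) = cnjV x"
    using arg_cong[OF level_iso_neg_cnjM_invol[OF assms, of x], of cnjV] by (simp add: cnjV_simps)
  moreover have "inj f" using f by (simp add: level_iso_def bij_is_inj)
  ultimately show ?thesis by (metis inv_f_f)
qed

section \<open>The quadruples \<open>A_Z\<close> and their isomorphisms\<close>

lemma F_Z_axis: "F_Z Z (axis i (1 / real N)) 0 = (1 / of_nat N) *s column i Z"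
  "F_Z Z 0 (axis i (1 / real N)) = (1 / of_nat N) *s unitv i"
proof -
  have s: "(\<chi> j. complex_of_real (axis i (1 / real N) $ j)) = (1 / of_nat N) *s unitv i"
    by (simp add: vec_eq_iff axis_def)
  have z: "(\<chi> j. complex_of_real ((0::real^'a) $ j)) = 0" by (simp add: vec_eq_iff)
  show "F_Z Z (axis i (1 / real N)) 0 = (1 / of_nat N) *s column i Z"
    "F_Z Z 0 (axis i (1 / real N)) = (1 / of_nat N) *s unitv i"
    unfolding F_Z_def s z by (simp_all add: vector_scalar_commute matrix_vector_mult_unitv)
qed

lemma A_Z_sel: "lat (A_Z N Z) = L_Z Z" "herm (A_Z N Z) = H_Z Z" "kap (A_Z N Z) = kappa_Z N Z"
  "lvU (A_Z N Z) = (\<lambda>i. (1 / of_nat N) *s column i Z)" "lvV (A_Z N Z) = (\<lambda>i. (1 / of_nat N) *s unitv i)"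
  by (simp_all add: A_Z_def F_Z_axis)

lemma A_Z_real_ppav_level:
  assumes S: "Z \<in> Sset N" and N: "N \<ge> 4"
  shows "real_ppav_level N (A_Z N Z)"
proof -
  obtain f where Z: "Z \<in> siegel" and f: "level_iso N Z (- cnjM Z) f" using S Sset_iff by blast
  interpret symp "H_Z Z" "L_Z Z" "\<lambda>i. column i Z" unitv using siegel_symp[OF Z] .
  have k: "kappa_Z N Z = (\<lambda>x. cnjV (f x))" using kappa_Z_eq[OF f Z N] by auto
  have f': "clinear f" "f ` L_Z Z = L_Z (- cnjM Z)" "\<And>x y. H_Z (- cnjM Z) (f x) (f y) = H_Z Z x y"
    "\<And>i. lat_cong N (L_Z (- cnjM Z)) (f (column i Z)) (column i (- cnjM Z))" "\<And>i. lat_cong N (L_Z (- cnjM Z)) (f (unitv i)) (unitv i)"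
    using f by (auto simp: level_iso_def)
  have L: "kappa_Z N Z ` L_Z Z = L_Z Z"
  proof -
    have "kappa_Z N Z ` L_Z Z = cnjV ` f ` L_Z Z" by (simp add: k image_image)
    then show ?thesis by (simp only: cnjV_L_Z neg_cnjM_invol f'(2))
  qed
  have H: "H_Z Z (kappa_Z N Z x) (kappa_Z N Z y) = cnj (H_Z Z x y)" for x y
    using H_Z_neg_cnjM[of "- cnjM Z" "f x" "f y"] by (simp only: neg_cnjM_invol k f'(3))
  have rs: "real_structure (H_Z Z) (L_Z Z) (kappa_Z N Z)"
    unfolding real_structure_def
    using L H level_iso_neg_cnjM_invol[OF f Z N] by (simp add: k cnjV_simps clinear_add[OF f'(1)] clinear_smult[OF f'(1)])
  \<comment> \<open>Conjugating the level conditions on \<open>f\<close> returns from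
    \<open>- cnjM Z\<close> to \<open>Z\<close> and produces the sign on the \<open>u\<close>
    half.\<close>
  have c: "lat_cong N (L_Z Z) (kappa_Z N Z (column i Z)) (- column i Z)" 
    "lat_cong N (L_Z Z) (kappa_Z N Z (unitv i)) (unitv i)" for i
    using lat_cong_cnjV[OF f'(4)[of i]] lat_cong_cnjV[OF f'(5)[of i]] 
    unfolding neg_cnjM_invol cnjV_column cnjV_simps k by simp_all
  have kn: "kappa_Z N Z ((1 / of_nat N) *s x) = (1 / of_nat N) *s kappa_Z N Z x" for x
    by (simp add: k clinear_smult[OF f'(1)] cnjV_simps)
  have n0: "N > 0" using N by simp
  have "kappa_Z N Z ((1 / of_nat N) *s column i Z) + (1 / of_nat N) *s column i Z \<in> L_Z Z"
    "kappa_Z N Z ((1 / of_nat N) *s unitv i) - (1 / of_nat N) *s unitv i \<in> L_Z Z" for i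
    using c[of i] unfolding lat_cong_iff[OF n0] kn by (simp_all)
  moreover have "is_lift N (A_Z N Z) (\<lambda>i. column i Z) unitv"
    unfolding is_lift_def A_Z_sel using sb L_zero by simp
  ultimately show ?thesis
    unfolding real_ppav_level_def ppav_def A_Z_sel using rs pdh sb by blast
qed

lemma rppav_iso_A_Z_iff:
  assumes S: "Z \<in> Sset N" "Z' \<in> Sset N" and N: "N \<ge> 4"
  shows "rppav_iso N (A_Z N Z) (A_Z N Z') \<longleftrightarrow> (\<exists>f. level_iso N Z Z' f)"
proof -
  have n0: "N > 0" using N by simp
  have ex: "lat_cong N L (g x) y \<longleftrightarrow> g ((1 / of_nat N) *s x) - (1 / of_nat N) *s y \<in> L" if "clinear g" for L and g :: "'a cvec \<Rightarrow> 'a cvec" and x y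
    unfolding lat_cong_iff[OF n0] clinear_smult[OF that] by simp
  have eq: "level_iso N Z Z' g \<longleftrightarrow> 
     clinear g \<and> bij g \<and> g ` lat (A_Z N Z) = lat (A_Z N Z') \<and>
     (\<forall>u v. herm (A_Z N Z') (g u) (g v) = herm (A_Z N Z) u v) \<and>
     (\<forall>i. g (lvU (A_Z N Z) i) - lvU (A_Z N Z') i \<in> lat (A_Z N Z') \<and> g (lvV (A_Z N Z) i) - lvV (A_Z N Z') i \<in> lat (A_Z N Z'))" for g
    unfolding level_iso_def A_Z_sel using ex by blast
  obtain f where Z: "Z \<in> siegel" and f: "level_iso N Z (- cnjM Z) f" using S Sset_iff by blast
  obtain f' where Z': "Z' \<in> siegel" and f': "level_iso N Z' (- cnjM Z') f'" using S Sset_iff by blast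
  \<comment> \<open>Conjugating \<open>g\<close> and precomposing with \<open>f\<close>, or
    following \<open>g\<close> by \<open>f'\<close>, gives two level isomorphisms from
    \<open>Z\<close> to \<open>- cnjM Z'\<close>. Their equality is the commutation with the real
    structures.\<close>
  have kap: "g \<circ> kap (A_Z N Z) = kap (A_Z N Z') \<circ> g" if g: "level_iso N Z Z' g" for g
  proof
    fix x
    have "level_iso N Z (- cnjM Z') ((\<lambda>x. cnjV (g (cnjV x))) \<circ> f)"
      using level_iso_comp[OF f level_iso_neg_cnjM[OF g Z'] siegel_neg_cnjM[OF Z']] .
    from level_iso_unique[OF this level_iso_comp[OF g f' siegel_neg_cnjM[OF Z']] Z N]
    have "cnjV (g (cnjV (f x))) = f' (g x)" by (simp add: fun_eq_iff)
    from arg_cong[OF this, of cnjV] show "(g \<circ> kap (A_Z N Z)) x = (kap (A_Z N Z') \<circ> g) x"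
      by (simp add: A_Z_sel kappa_Z_eq[OF f Z N] kappa_Z_eq[OF f' Z' N] cnjV_simps)
  qed
  have "rppav_iso N (A_Z N Z) (A_Z N Z') \<longleftrightarrow> (\<exists>g. level_iso N Z Z' g \<and> g \<circ> kap (A_Z N Z) = kap (A_Z N Z') \<circ> g)"
    unfolding rppav_iso_def eq clinear_def by (rule arg_cong[of _ _ Ex]) (rule ext, argo)
  then show ?thesis using kap by blast
qed

text \<open>The period isomorphism of a compatible lift transports \<open>kap X\<close> to an
  antilinear involution of \<open>A_Z\<close>. Followed by conjugation it is a level isomorphism
  from \<open>Z\<close> to \<open>- cnjM Z\<close>, which puts \<open>Z\<close> in
  \<open>Sset N\<close> and identifies the involution with \<open>kappa_Z\<close>.\<close>

lemma rppav_iso_to_A_Z: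
  assumes X: "real_ppav_level N X" and N: "N \<ge> 4"
  shows "\<exists>Z\<in>Sset N. rppav_iso N X (A_Z N Z)"
proof -
  have n0: "N > 0" using N by simp
  obtain u v where P: "pos_def_hermitian (herm X)" and rs: "real_structure (herm X) (lat X) (kap X)"
    and sb: "symplectic_basis (herm X) (lat X) u v" and
    lv: "\<And>i. lvU X i - (1 / of_nat N) *s u i \<in> lat X" "\<And>i. lvV X i - (1 / of_nat N) *s v i \<in> lat X"
    and kc: "\<And>i. kap X ((1 / of_nat N) *s u i) + (1 / of_nat N) *s u i \<in> lat X"
       "\<And>i. kap X ((1 / of_nat N) *s v i) - (1 / of_nat N) *s v i \<in> lat X"
    using X unfolding real_ppav_level_def is_lift_def ppav_def by blast
  interpret symp "herm X" "lat X" u v using P sb by unfold_locales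
  have k: "\<And>x y. kap X (x + y) = kap X x + kap X y" "\<And>c x. kap X (c *s x) = cnj c *s kap X x"
    "\<And>x. kap X (kap X x) = x" "kap X ` lat X = lat X" "\<And>x y. Im (herm X (kap X x) (kap X y)) = - Im (herm X x y)"
    using rs by (auto simp: real_structure_def)
  \<comment> \<open>The real structure controls only \<open>Im H\<close>; applying its condition to
    \<open>-i x\<close> and using antilinearity recovers the real part.\<close>
  have kH: "herm X (kap X x) (kap X y) = cnj (herm X x y)" for x y
    using k(5)[of x y] k(5)[of "(- \<i>) *s x" y] unfolding k(2)
    by (simp add: complex_eq_iff smult_left minus_left vector_smult_lneg)
  obtain Z g where g: "Z \<in> siegel" "clinear g" "bij g" "\<And>i. g (u i) = column i Z" "\<And>i. g (v i) = unitv i"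
    "g ` lat X = L_Z Z" "\<And>x y. H_Z Z (g x) (g y) = herm X x y" by (rule period) blast
  have i: "inv g (g x) = x" "g (inv g x) = x" for x
    using g(3) by (simp_all add: bij_is_inj bij_is_surj surj_f_inv_f)
  have ci: "clinear (inv g)" using clinear_inv[OF g(2,3)] .
  have gi: "inv g ` L_Z Z = lat X" unfolding g(6)[symmetric] by (simp add: image_image i)
  have Hi: "herm X (inv g x) (inv g y) = H_Z Z x y" for x y using g(7)[of "inv g x" "inv g y"] by (simp add: i)
  define \<kappa> where "\<kappa> x = g (kap X (inv g x))" for x
  define f where "f x = cnjV (\<kappa> x)" for x
  have kk: "\<kappa> (\<kappa> x) = x" for x by (simp add: \<kappa>_def i k(3))
  have ff: "level_iso N Z (- cnjM Z) f"
    unfolding level_iso_def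
  proof (intro conjI allI)
    show "clinear f"
      by (simp add: clinear_def f_def \<kappa>_def k(1,2) cnjV_simps clinear_add[OF g(2)] clinear_smult[OF g(2)] clinear_add[OF ci] clinear_smult[OF ci])
    show "bij f"
      by (rule bij_betw_byWitness[of _ "\<lambda>x. \<kappa> (cnjV x)"]) (auto simp: f_def kk cnjV_simps)
    have "f ` L_Z Z = cnjV ` g ` kap X ` inv g ` L_Z Z" by (simp add: f_def \<kappa>_def image_image)
    then show "f ` L_Z Z = L_Z (- cnjM Z)" by (simp only: gi k(4) g(6) cnjV_L_Z)
    show "H_Z (- cnjM Z) (f x) (f y) = H_Z Z x y" for x y
      by (simp add: f_def \<kappa>_def H_Z_neg_cnjM g(7) kH Hi)
    have "lat_cong N (lat X) (kap X (u i)) (- u i)" "lat_cong N (lat X) (kap X (v i)) (v i)" for i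
      unfolding lat_cong_iff[OF n0] using kc[of i] by (simp_all add: k(2))
    from lat_cong_image[OF g(2) this(1) g(6)] lat_cong_image[OF g(2) this(2) g(6)]
    have c: "lat_cong N (L_Z Z) (\<kappa> (column i Z)) (- column i Z)" "lat_cong N (L_Z Z) (\<kappa> (unitv i)) (unitv i)" for i
      unfolding \<kappa>_def by (simp_all add: g(4,5)[symmetric] i clinear_minus[OF g(2)])
    show "lat_cong N (L_Z (- cnjM Z)) (f (column i Z)) (column i (- cnjM Z))" for i
      using lat_cong_cnjV[OF c(1)[of i]] by (simp add: f_def cnjV_simps cnjV_column)
    show "lat_cong N (L_Z (- cnjM Z)) (f (unitv i)) (unitv i)" for i
      using lat_cong_cnjV[OF c(2)[of i]] by (simp add: f_def cnjV_simps)
  qed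
  then have "Z \<in> Sset N" using Sset_iff g(1) by blast
  moreover have "rppav_iso N X (A_Z N Z)"
    unfolding rppav_iso_def
  proof (rule exI[of _ g], intro conjI)
    show "g \<circ> kap X = kap (A_Z N Z) \<circ> g"
      by (simp add: fun_eq_iff A_Z_sel kappa_Z_eq[OF ff g(1) N] f_def \<kappa>_def cnjV_simps i)
    have "g (lvU X i - (1 / of_nat N) *s u i) \<in> L_Z Z" "g (lvV X i - (1 / of_nat N) *s v i) \<in> L_Z Z" for i
      using lv[of i] g(6) by blast+
    then show "\<forall>i. g (lvU X i) - lvU (A_Z N Z) i \<in> lat (A_Z N Z) \<and> g (lvV X i) - lvV (A_Z N Z) i \<in> lat (A_Z N Z)"
      by (simp add: A_Z_sel clinear_diff[OF g(2)] clinear_smult[OF g(2)] g(4,5))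
  qed (use g in \<open>auto simp: A_Z_sel clinear_def\<close>)
  ultimately show ?thesis by blast
qed

section \<open>Isomorphism classes and the bijection\<close>

lemma rppav_iso_refl: assumes "real_ppav_level N X" shows "rppav_iso N X X"
proof -
  obtain u v where "symp (herm X) (lat X) u v"
    using assms by (auto simp: real_ppav_level_def ppav_def symp_def symp_axioms_def pd_herm_def)
  then show ?thesis unfolding rppav_iso_def by (intro exI[of _ id]) (simp add: symp.L_zero)
qed

lemma rppav_iso_sym:
  assumes X: "real_ppav_level N X" and iso: "rppav_iso N X Y"
  shows "rppav_iso N Y X"
proof -
  obtain u v where "symp (herm X) (lat X) u v"
    using X by (auto simp: real_ppav_level_def ppav_def symp_def symp_axioms_def pd_herm_def)
  then interpret symp "herm X" "lat X" u v .
  obtain f where f: "clinear f" "bij f" "f ` lat X = lat Y" "\<And>u v. herm Y (f u) (f v) = herm X u v"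
    "f \<circ> kap X = kap Y \<circ> f" "\<And>i. f (lvU X i) - lvU Y i \<in> lat Y" "\<And>i. f (lvV X i) - lvV Y i \<in> lat Y"
    using iso unfolding rppav_iso_def clinear_def by blast
  have i: "inv f (f x) = x" "f (inv f x) = x" for x
    using f(2) by (simp_all add: bij_is_inj bij_is_surj surj_f_inv_f)
  have ci: "clinear (inv f)" using clinear_inv[OF f(1,2)] .
  have L: "inv f ` lat Y = lat X" unfolding f(3)[symmetric] by (simp add: image_image i)
  have H: "herm X (inv f x) (inv f y) = herm Y x y" for x y using f(4)[of "inv f x" "inv f y"] by (simp add: i)
  have k: "inv f (kap Y x) = kap X (inv f x)" for x
    using arg_cong[OF fun_cong[OF f(5), of "inv f x"], of "inv f"] by (simp add: i)
  have lv: "inv f y - x \<in> lat X" if "f x - y \<in> lat Y" for x y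
  proof -
    have "inv f (f x - y) \<in> lat X" using that L by blast
    then have "- (inv f (f x - y)) \<in> lat X" by (rule L_minus)
    then show ?thesis by (simp add: clinear_diff[OF ci] i)
  qed
  show ?thesis unfolding rppav_iso_def
    by (rule exI[of _ "inv f"])
      (use ci L H k lv[OF f(6)] lv[OF f(7)] f(2) in \<open>simp add: clinear_def fun_eq_iff bij_imp_bij_inv\<close>)
qed

lemma rppav_iso_trans:
  assumes W: "real_ppav_level N W" and iso: "rppav_iso N X Y" "rppav_iso N Y W"
  shows "rppav_iso N X W"
proof -
  obtain u v where "symp (herm W) (lat W) u v"
    using W by (auto simp: real_ppav_level_def ppav_def symp_def symp_axioms_def pd_herm_def)
  then interpret symp "herm W" "lat W" u v .
  obtain f where f: "clinear f" "bij f" "f ` lat X = lat Y" "\<And>u v. herm Y (f u) (f v) = herm X u v"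
    "f \<circ> kap X = kap Y \<circ> f" "\<And>i. f (lvU X i) - lvU Y i \<in> lat Y" "\<And>i. f (lvV X i) - lvV Y i \<in> lat Y"
    using iso(1) unfolding rppav_iso_def clinear_def by blast
  obtain g where g: "clinear g" "bij g" "g ` lat Y = lat W" "\<And>u v. herm W (g u) (g v) = herm Y u v"
    "g \<circ> kap Y = kap W \<circ> g" "\<And>i. g (lvU Y i) - lvU W i \<in> lat W" "\<And>i. g (lvV Y i) - lvV W i \<in> lat W"
    using iso(2) unfolding rppav_iso_def clinear_def by blast
  have lv: "g (f x) - z \<in> lat W" if "f x - y \<in> lat Y" "g y - z \<in> lat W" for x y z
  proof -
    have "g (f x - y) \<in> lat W" using that(1) g(3) by blast
    from L_add[OF this that(2)] show ?thesis by (simp add: clinear_diff[OF g(1)])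
  qed
  have "(g \<circ> f) ` lat X = lat W" unfolding image_comp[symmetric] f(3) g(3) ..
  moreover have "g \<circ> f \<circ> kap X = kap W \<circ> (g \<circ> f)"
    using fun_cong[OF f(5)] fun_cong[OF g(5)] by (simp add: fun_eq_iff)
  ultimately show ?thesis unfolding rppav_iso_def
    using clinear_comp[OF g(1) f(1)] bij_comp[OF f(2) g(2)] f(4) g(4) lv[OF f(6) g(6)] lv[OF f(7) g(7)]
    by (intro exI[of _ "g \<circ> f"]) (simp add: clinear_def)
qed

lemma iso_class_eq_iff:
  assumes "real_ppav_level N X" "real_ppav_level N Y"
  shows "iso_class N X = iso_class N Y \<longleftrightarrow> rppav_iso N X Y"
proof
  assume "iso_class N X = iso_class N Y"
  then have "Y \<in> iso_class N X" using assms(2) rppav_iso_refl by (auto simp: iso_class_def)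
  then show "rppav_iso N X Y" by (simp add: iso_class_def)
next
  assume XY: "rppav_iso N X Y"
  show "iso_class N X = iso_class N Y"
    unfolding iso_class_def
    using rppav_iso_trans[OF _ XY] rppav_iso_trans[OF _ rppav_iso_sym[OF assms(1) XY]] by blast
qed

lemma iso_classes_eq: "iso_classes N = iso_class N ` {X. real_ppav_level N X}"
  unfolding iso_classes_def quotient_def iso_class_def by auto

text \<open>The orbit of \<open>Z\<close> is fixed exactly when a level isomorphism joins
  \<open>Z\<close> to \<open>- cnjM Z\<close>, so every point of a fixed orbit lies in
  \<open>Sset N\<close>.\<close>

lemma X_R_eq: "X_R N = orbit N ` Sset N"
proof -
  have "orbit N (- cnjM Z) = orbit N Z \<longleftrightarrow> Z \<in> Sset N" if "Z \<in> siegel" for Z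
    using orbit_eq_iff[OF that siegel_neg_cnjM[OF that], of N] that by (auto simp: Sset_iff)
  then show ?thesis unfolding X_R_def using Sset_iff by blast
qed

theorem theorem6p6:
  fixes m :: nat
  assumes "m \<ge> 1"
  defines "N \<equiv> 4 * m"
  shows "(\<forall>Z \<in> (Sset N :: ('n::finite) cmat set). \<exists>!\<gamma>. \<gamma> \<in> Gamma N \<and> act \<gamma> Z = - cnjM Z)
       \<and> (\<forall>Z \<in> (Sset N :: ('n::finite) cmat set). real_ppav_level N (A_Z N Z))
       \<and> (\<exists>\<Phi>. bij_betw \<Phi> (X_R N :: ('n::finite) cmat set set) (iso_classes N)
              \<and> (\<forall>Z \<in> Sset N. \<Phi> (orbit N Z) = iso_class N (A_Z N Z)))"
proof (intro conjI)
  have N: "N \<ge> 4" using assms by (simp add: N_def)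
  show "\<forall>Z \<in> (Sset N :: 'n cmat set). \<exists>!\<gamma>. \<gamma> \<in> Gamma N \<and> act \<gamma> Z = - cnjM Z"
    using Sset_ex1[OF _ N] by blast
  show lev: "\<forall>Z \<in> (Sset N :: 'n cmat set). real_ppav_level N (A_Z N Z)"
    using A_Z_real_ppav_level[OF _ N] by blast
  \<comment> \<open>A representative in \<open>Sset N\<close> is chosen; by \<open>iff\<close> below
    the class does not depend on it, and the same equivalence gives injectivity.\<close>
  define \<Phi> :: "'n cmat set \<Rightarrow> 'n rppav set" where
    "\<Phi> X = iso_class N (A_Z N (SOME Z. Z \<in> Sset N \<and> orbit N Z = X))" for X
  have iff: "iso_class N (A_Z N Z) = iso_class N (A_Z N Z') \<longleftrightarrow> orbit N Z = orbit N Z'"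
    if "Z \<in> Sset N" "Z' \<in> Sset N" for Z Z' :: "'n cmat"
  proof -
    have "Z \<in> siegel" "Z' \<in> siegel" using that by (auto simp: Sset_iff)
    then show ?thesis
      using iso_class_eq_iff[OF lev[rule_format, OF that(1)] lev[rule_format, OF that(2)]]
        rppav_iso_A_Z_iff[OF that N] orbit_eq_iff[of Z Z' N] by blast
  qed
  have Phi: "\<Phi> (orbit N Z) = iso_class N (A_Z N Z)" if "Z \<in> Sset N" for Z
  proof -
    have "(SOME Z'. Z' \<in> Sset N \<and> orbit N Z' = orbit N Z) \<in> Sset N \<and>
        orbit N (SOME Z'. Z' \<in> Sset N \<and> orbit N Z' = orbit N Z) = orbit N Z"
      by (rule someI[of _ Z]) (use that in blast)
    then show ?thesis unfolding \<Phi>_def using iff that by blast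
  qed
  have "inj_on \<Phi> (X_R N)" unfolding X_R_eq by (rule inj_onI) (auto simp: Phi iff)
  moreover have "\<Phi> ` X_R N = iso_classes N"
  proof (intro equalityI subsetI)
    fix c :: "'n rppav set" assume "c \<in> iso_classes N"
    then obtain X where X: "real_ppav_level N X" "c = iso_class N X" by (auto simp: iso_classes_eq)
    \<comment> \<open>Surjectivity: every class contains some \<open>A_Z\<close>, by taking the
      period of a compatible lift.\<close>
    obtain Z where Z: "Z \<in> Sset N" "rppav_iso N X (A_Z N Z)" using rppav_iso_to_A_Z[OF X(1) N] by blast
    then have "c = iso_class N (A_Z N Z)" using X(2) iso_class_eq_iff[OF X(1) lev[rule_format, OF Z(1)]] by simp
    then show "c \<in> \<Phi> ` X_R N" unfolding X_R_eq using Z(1) Phi by auto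
  next
    fix c :: "'n rppav set" assume "c \<in> \<Phi> ` X_R N"
    then show "c \<in> iso_classes N" unfolding X_R_eq iso_classes_eq using Phi lev by auto
  qed
  ultimately show "\<exists>\<Phi>. bij_betw \<Phi> (X_R N :: 'n cmat set set) (iso_classes N)
              \<and> (\<forall>Z \<in> Sset N. \<Phi> (orbit N Z) = iso_class N (A_Z N Z))"
    using Phi by (intro exI[of _ \<Phi>]) (simp add: bij_betw_def)
qed

end
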